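(* Let $0<p\le\infty$, $r,k\in\mathbb{N}$, $0<\alpha\le r$, and $p_1=\min(p,1)$. Then there is a constant $C$, independent of $f$ and $n$, such that for every $f\in H_p^{r,\alpha}$ and $n\in\mathbb{N}$ $$\psi_{k,r,\alpha}\left(f,\tfrac1n\right)_p\le\frac{C}{n^k}\left(\sum_{\nu=0}^n(\nu+1)^{kp_1-1}E_\nu(f)_{H_p^{r,\alpha}}^{p_1}\right)^{1/p_1}.$$
   Context: $\mathbb{T}\cong[0,2\pi)$ is the torus; functions are complex-valued and $2\pi$-periodic. For $0<p<\infty$, $L_p=L_p(\mathbb{T})$ is the space of measurable functions with $\|f\|_p=\left(\frac1{2\pi}\int_{\mathbb{T}}|f(x)|^p\,dx\right)^{1/p}<\infty$; $L_\infty$ denotes the space of $2\pi$-periodic continuous functions with $\|f\|_\infty=\max|f|$. For $k\in\mathbb{N}=\{1,2,\dots\}$: $\Delta_\delta^k f(x)=\sum_{\nu=0}^k(-1)^\nu\binom k\nu f(x+\nu\delta)$ and $\omega_k(f,t)_p=\sup_{0<\delta<t}\|\Delta_\delta^kf\|_p$. For $0<p\le\infty$, $r\in\mathbb{N}$, $0<\alpha\le r$: $f\in H_p^{r,\alpha}$ if $f\in L_p$ and $\|f\|_{H_p^{r,\alpha}}=\|f\|_p+|f|_{H_p^{r,\alpha}}<\infty$, where $|f|_{H_p^{r,\alpha}}=\sup_{h>0}h^{-\alpha}\|\Delta_h^rf\|_p$. For $n\in\mathbb{N}\cup\{0\}$, $\mathcal{T}_n$ is the set of trigonometric polynomials $\sum_{\nu=-n}^nc_\nu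 e^{i\nu x}$, $c_\nu\in\mathbb{C}$, and $E_n(f)_{H_p^{r,\alpha}}=\inf_{T\in\mathcal{T}_n}\|f-T\|_{H_p^{r,\alpha}}$. Further, $\psi_{k,r,\alpha}(f,\delta)_p=\sup_{0<h\le\delta}h^{-\alpha}\omega_k(\Delta_h^rf,\delta)_p$. *)

theory Defs
  imports "HOL-Analysis.Analysis"
begin

text \<open>
  Functions on the torus are represented as everywhere \<open>2\<pi>\<close>-periodic functions
  \<open>real \<Rightarrow> complex\<close>; functions equal almost everywhere are not identified.
  The exponent \<open>p\<close> ranges over \<^typ>\<open>ennreal\<close>, and all (quasi-)norms, moduli of smoothness
  and best approximations take values in \<^typ>\<open>ennreal\<close>, so that suprema always exist and
  finiteness of a norm is an explicit condition.
\<close>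

text \<open>Extension of \<^const>\<open>powr\<close> by \<open>\<infinity>\<^sup>a = \<infinity>\<close>; it is only used for \<open>a > 0\<close>.\<close>

definition ennreal_powr :: "ennreal \<Rightarrow> real \<Rightarrow> ennreal" where
  "ennreal_powr x a = (if x = \<infinity> then \<infinity> else ennreal (enn2real x powr a))"

definition periodic_2pi :: "(real \<Rightarrow> complex) \<Rightarrow> bool" where
  "periodic_2pi f \<longleftrightarrow> (\<forall>x. f (x + 2 * pi) = f x)"

definition Lp_norm :: "ennreal \<Rightarrow> (real \<Rightarrow> complex) \<Rightarrow> ennreal" where
  "Lp_norm p f =
    (if p = \<infinity> then (SUP x. ennreal (norm (f x)))
     else ennreal_powr
       (ennreal (1 / (2 * pi)) *
         (\<integral>\<^sup>+ x \<in> {0..<2 * pi}. ennreal (norm (f x) powr enn2real p) \<partial>lebesgue))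
       (1 / enn2real p))"

text \<open>For \<open>p = \<infinity>\<close> the space consists of the continuous periodic functions.\<close>

definition Lp_space :: "ennreal \<Rightarrow> (real \<Rightarrow> complex) set" where
  "Lp_space p =
    {f. periodic_2pi f \<and>
        (if p = \<infinity> then continuous_on UNIV f
         else f \<in> borel_measurable lebesgue \<and> Lp_norm p f < \<infinity>)}"

definition fdiff :: "nat \<Rightarrow> real \<Rightarrow> (real \<Rightarrow> complex) \<Rightarrow> real \<Rightarrow> complex" where
  "fdiff k \<delta> f = (\<lambda>x. \<Sum>\<nu>=0..k. (-1) ^ \<nu> * of_nat (k choose \<nu>) * f (x + real \<nu> * \<delta>))"

definition modulus :: "nat \<Rightarrow> ennreal \<Rightarrow> (real \<Rightarrow> complex) \<Rightarrow> real \<Rightarrow> ennreal" where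
  "modulus k p f t = (SUP \<delta>\<in>{0<..<t}. Lp_norm p (fdiff k \<delta> f))"

definition holder_seminorm :: "ennreal \<Rightarrow> nat \<Rightarrow> real \<Rightarrow> (real \<Rightarrow> complex) \<Rightarrow> ennreal" where
  "holder_seminorm p r \<alpha> f = (SUP h\<in>{0<..}. ennreal (h powr - \<alpha>) * Lp_norm p (fdiff r h f))"

definition holder_norm :: "ennreal \<Rightarrow> nat \<Rightarrow> real \<Rightarrow> (real \<Rightarrow> complex) \<Rightarrow> ennreal" where
  "holder_norm p r \<alpha> f = Lp_norm p f + holder_seminorm p r \<alpha> f"

definition holder_space :: "ennreal \<Rightarrow> nat \<Rightarrow> real \<Rightarrow> (real \<Rightarrow> complex) set" where
  "holder_space p r \<alpha> = {f \<in> Lp_space p. holder_norm p r \<alpha> f < \<infinity>}"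

definition trig_polys :: "nat \<Rightarrow> (real \<Rightarrow> complex) set" where
  "trig_polys n =
    {T. \<exists>c :: int \<Rightarrow> complex.
          T = (\<lambda>x. \<Sum>\<nu>=- int n..int n. c \<nu> * exp (\<i> * of_int \<nu> * of_real x))}"

definition best_approx :: "ennreal \<Rightarrow> nat \<Rightarrow> real \<Rightarrow> nat \<Rightarrow> (real \<Rightarrow> complex) \<Rightarrow> ennreal" where
  "best_approx p r \<alpha> n f = (INF T\<in>trig_polys n. holder_norm p r \<alpha> (\<lambda>x. f x - T x))"

definition psi_modulus ::
  "nat \<Rightarrow> nat \<Rightarrow> real \<Rightarrow> ennreal \<Rightarrow> (real \<Rightarrow> complex) \<Rightarrow> real \<Rightarrow> ennreal" where
  "psi_modulus k r \<alpha> p f \<delta> =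
    (SUP h\<in>{0<..\<delta>}. ennreal (h powr - \<alpha>) * modulus k p (fdiff r h f) \<delta>)"

end

theory Submission
  imports Defs
begin

text \<open>
  Write \<open>q = min p 1\<close> and work with the \<open>q\<close>-th powers of the norms, which are subadditive for
  every \<open>p > 0\<close> (\<open>qnorm_add\<close>). Let \<open>T \<nu>\<close> be a nearly best approximation of \<open>f\<close> of degree \<open>\<nu>\<close>
  in the Hoelder norm, and let \<open>2 ^ m \<le> n < 2 ^ (m + 1)\<close>. Decompose \<open>f\<close> into \<open>f - T (2 ^ m)\<close>,
  the dyadic differences \<open>T (2 ^ (j + 1)) - T (2 ^ j)\<close> with \<open>j < m\<close>, the difference \<open>T 1 - T 0\<close>
  and the constant \<open>T 0\<close>, which is annihilated by \<open>fdiff r h\<close>. For the first part the \<open>k\<close>-th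
  difference is bounded trivially. If \<open>Q\<close> is one of the differences, of degree \<open>N\<close>, then
  \<open>fdiff r h Q\<close> is a trigonometric polynomial of degree \<open>N\<close> as well. The Bernstein inequality
  \<open>\<parallel>fdiff k \<delta> S\<parallel> \<le> C * (\<delta> * N) ^ k * \<parallel>S\<parallel>\<close> for \<open>\<delta> * N \<le> 1\<close> (\<open>bernstein_fdiff\<close>), applied to
  \<open>S = fdiff r h Q\<close>, gains the factor \<open>(N / n) ^ k\<close> and leaves a quantity bounded by the
  Hoelder seminorm of \<open>Q\<close>, hence by the errors of two approximations (\<open>mixed_difference_le\<close>).
  The resulting sum over the degrees \<open>2 ^ j\<close> is dominated by the sum over all \<open>\<nu> \<le> n\<close>, since
  the best approximations decrease (\<open>dyadic_sum_le\<close>).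

  The Bernstein inequality is needed for all \<open>p > 0\<close>. It follows from a discrete reproducing
  formula (\<open>trig_poly_interpolation\<close>): a trigonometric polynomial \<open>T\<close> of degree \<open>N\<close> is a
  combination of its values at equidistant nodes, whose number is a multiple of \<open>N\<close>, with
  a kernel that decays like an arbitrarily prescribed power of the distance. As the nodes may be
  translated along with the argument, \<open>T x - T (x + \<delta>)\<close> is a finite combination of translates
  of \<open>T\<close>, and the sum of the \<open>q\<close>-th powers of its coefficients is at most a constant times
  \<open>(\<delta> * N) powr q\<close> (\<open>sum_kernel_differences_le\<close>).
\<close>

section \<open>Powers of extended nonnegative reals\<close>

lemma ennreal_powr_ennreal: "0 \<le> x \<Longrightarrow> ennreal_powr (ennreal x) a = ennreal (x powr a)"
  by (simp add: ennreal_powr_def)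

lemma ennreal_powr_one [simp]: "ennreal_powr x 1 = x"
  by (cases x) (auto simp: ennreal_powr_ennreal ennreal_powr_def)

lemma ennreal_powr_mono:
  assumes "x \<le> y" "0 < a" shows "ennreal_powr x a \<le> ennreal_powr y a"
proof (cases y)
  case (real v)
  with assms(1) obtain u where "x = ennreal u" "0 \<le> u" "u \<le> v"
    by (cases x) (auto simp: top_unique)
  with real assms(2) show ?thesis
    by (auto simp: ennreal_powr_ennreal intro!: ennreal_leI powr_mono2)
qed (simp add: ennreal_powr_def)

lemma ennreal_powr_powr:
  assumes "0 < a" "0 < b" shows "ennreal_powr (ennreal_powr x a) b = ennreal_powr x (a * b)"
  using assms by (cases x) (auto simp: ennreal_powr_ennreal powr_powr ennreal_powr_def)

lemma ennreal_powr_mult: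
  assumes "0 < a" shows "ennreal_powr (x * y) a = ennreal_powr x a * ennreal_powr y a"
proof (cases "x = \<infinity> \<or> y = \<infinity>")
  case True
  then show ?thesis using assms
    by (auto simp: ennreal_powr_def ennreal_top_mult ennreal_mult_top ennreal_eq_0_iff enn2real_eq_0_iff)
next
  case False
  then obtain u v where "x = ennreal u" "0 \<le> u" "y = ennreal v" "0 \<le> v"
    by (cases x; cases y) auto
  then show ?thesis
    by (simp add: ennreal_powr_ennreal ennreal_mult[symmetric] powr_mult)
qed

lemma ennreal_powr_le_imp_le:
  assumes "ennreal_powr x a \<le> ennreal y" "0 < a" "0 \<le> y" shows "x \<le> ennreal (y powr (1 / a))"
proof -
  have "ennreal_powr (ennreal_powr x a) (1 / a) \<le> ennreal_powr (ennreal y) (1 / a)"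
    using assms by (intro ennreal_powr_mono) auto
  then show ?thesis
    using assms by (simp add: ennreal_powr_powr ennreal_powr_ennreal)
qed

section \<open>Power inequalities\<close>

lemma powr_add_le_add_powr:
  fixes x y a :: real
  assumes "0 \<le> x" "0 \<le> y" "0 < a" "a \<le> 1"
  shows "(x + y) powr a \<le> x powr a + y powr a"
proof (cases "x = 0 \<or> y = 0")
  case True then show ?thesis using assms by auto
next
  case False
  with assms have pos: "0 < x" "0 < y" by auto
  have split: "z powr a = z * z powr (a - 1)" if "0 < z" for z :: real
    using that by (simp add: powr_mult_base)
  have "(x + y) powr a = x * (x + y) powr (a - 1) + y * (x + y) powr (a - 1)"
    using pos split[of "x + y"] by (simp add: distrib_right)
  also have "\<dots> \<le> x * x powr (a - 1) + y * y powr (a - 1)"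
    using pos assms by (intro add_mono mult_left_mono powr_mono2') auto
  finally show ?thesis using pos split by simp
qed

text \<open>The pointwise form of Minkowski's inequality: with \<open>a\<close> and \<open>b\<close> bounding the two
  norms, integrating it gives \<open>(a + b) powr p\<close> on the right.\<close>

lemma powr_add_le_weighted:
  fixes u v a b p :: real
  assumes "0 \<le> u" "0 \<le> v" "0 < a" "0 < b" "1 \<le> p"
  shows "(u + v) powr p \<le> (a + b) powr (p - 1) * (a powr (1 - p) * u powr p
      + b powr (1 - p) * v powr p)"
proof -
  define t where "t = a / (a + b)"
  have t: "0 < t" "t < 1" "1 - t = b / (a + b)"
    using assms by (auto simp: t_def field_simps)
  have convex: "(t * x + (1 - t) * y) powr p \<le> t * x powr p + (1 - t) * y powr p"
    if xy: "0 \<le> x" "0 \<le> y" for x y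
  proof -
    have contract: "(s * z) powr p \<le> s * z powr p" if "0 < s" "s < 1" "0 \<le> z" for s z :: real
      using powr_mono'[of 1 p s] that assms by (simp add: powr_mult mult_right_mono)
    consider "x = 0" | "y = 0" | "0 < x" "0 < y" using xy by fastforce
    then show ?thesis
    proof cases
      case 1 then show ?thesis using contract[of "1 - t" y] t xy assms by simp
    next
      case 2 then show ?thesis using contract[of t x] t xy assms by simp
    next
      case 3 then show ?thesis
        using convex_onD[OF powr_convex[OF assms(5)], of "1 - t" x y] t(1,2) by simp
    qed
  qed
  have "(a + b) * t = a" "(a + b) * (1 - t) = b"
    using assms unfolding t(3) by (simp_all add: t_def)
  then have "(a + b) * (t * (u / a) + (1 - t) * (v / b)) = u + v"
    using assms by (simp add: distrib_left mult.assoc[symmetric])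
  then have "(u + v) powr p = ((a + b) * (t * (u / a) + (1 - t) * (v / b))) powr p"
    by simp
  also have "\<dots> = (a + b) powr p * (t * (u / a) + (1 - t) * (v / b)) powr p"
    using assms by (simp add: powr_mult)
  also have "\<dots> \<le> (a + b) powr p * (t * (u / a) powr p + (1 - t) * (v / b) powr p)"
    using assms convex[of "u / a" "v / b"] by (intro mult_left_mono) auto
  also have "\<dots> = (a + b) powr (p - 1) * (a powr (1 - p) * u powr p + b powr (1 - p) * v powr p)"
  proof -
    have "t * (u / a) powr p = a powr (1 - p) * u powr p / (a + b)"
      "(1 - t) * (v / b) powr p = b powr (1 - p) * v powr p / (a + b)"
      using assms unfolding t(3) by (simp_all add: t_def powr_divide powr_diff)
    moreover have "(a + b) powr (p - 1) = (a + b) powr p / (a + b)"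
      using assms by (simp add: powr_diff)
    ultimately show ?thesis by (simp add: distrib_left add_divide_distrib)
  qed
  finally show ?thesis .
qed

section \<open>A subadditive power of the norm\<close>

text \<open>
  The periodic measurable functions. The class does not depend on \<open>p\<close> and contains every
  \<open>Lp_space p\<close>, in particular the continuous functions of the case \<open>p = \<infinity>\<close>.
\<close>

definition torus_fun :: "(real \<Rightarrow> complex) \<Rightarrow> bool" where
  "torus_fun f \<longleftrightarrow> periodic_2pi f \<and> f \<in> borel_measurable lebesgue"

text \<open>
  The mean value of \<open>|f|\<^sup>P\<close> over one period, that is, the \<open>P\<close>-th power of the norm for a
  finite exponent \<open>P\<close>.
\<close>

definition mean_powr :: "real \<Rightarrow> (real \<Rightarrow> complex) \<Rightarrow> ennreal" where
  "mean_powr P f =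
    ennreal (1 / (2 * pi)) *
      (\<integral>\<^sup>+ x \<in> {0..<2 * pi}. ennreal (norm (f x) powr P) \<partial>lebesgue)"

text \<open>
  The power \<open>\<parallel>f\<parallel>\<^sub>p\<^sup>q\<close> of the norm with \<open>q = min p 1\<close>. It is subadditive for every \<open>p\<close>,
  which allows \<open>p < 1\<close> and \<open>p \<ge> 1\<close> to be treated together.
\<close>

definition qnorm :: "ennreal \<Rightarrow> (real \<Rightarrow> complex) \<Rightarrow> ennreal" where
  "qnorm p f = ennreal_powr (Lp_norm p f) (enn2real (min p 1))"

lemma min_one_exponent:
  assumes "0 < (p :: ennreal)" shows "0 < enn2real (min p 1)" "enn2real (min p 1) \<le> 1"
proof -
  have "min p 1 \<le> 1" by simp
  then have "min p 1 < \<infinity>" by (rule le_less_trans) simp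
  with assms show "0 < enn2real (min p 1)"
    by (auto simp: enn2real_positive_iff)
  show "enn2real (min p 1) \<le> 1"
    by (rule enn2real_leI) auto
qed

lemma Lp_norm_finite_exponent:
  "p \<noteq> \<infinity> \<Longrightarrow> Lp_norm p f = ennreal_powr (mean_powr (enn2real p) f) (1 / enn2real p)"
  by (simp add: Lp_norm_def mean_powr_def)

lemma mean_powr_integrand_measurable:
  assumes "torus_fun f"
  shows "(\<lambda>x. ennreal (norm (f x) powr P)) \<in> borel_measurable lebesgue"
proof -
  have [measurable]: "f \<in> borel_measurable lebesgue" using assms by (simp add: torus_fun_def)
  show ?thesis by measurable
qed

lemma weighted_integrand_measurable:
  assumes "torus_fun f"
  shows "(\<lambda>x. ennreal (norm (f x) powr P) * indicator {a..<b :: real} x) \<in> borel_measurable lebesgue"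
proof -
  have "(indicator {a..<b} :: real \<Rightarrow> ennreal) \<in> borel_measurable lebesgue"
    by (intro measurable_completion borel_measurable_indicator) auto
  with mean_powr_integrand_measurable[OF assms, of P] show ?thesis
    by (rule borel_measurable_times_ennreal)
qed

text \<open>Only translations by less than a period are needed, so a single wrap-around
  of the interval suffices.\<close>

lemma mean_powr_translate:
  assumes f: "torus_fun f" and t: "0 \<le> t" "t < 2 * pi"
  shows "mean_powr P (\<lambda>x. f (x + t)) = mean_powr P f"
proof -
  define F where "F x = ennreal (norm (f x) powr P)" for x
  have per: "F (x + 2 * pi) = F x" for x
    using f by (simp add: F_def torus_fun_def periodic_2pi_def)
  have meas: "(\<lambda>x. F x * indicator {a..<b} x) \<in> borel_measurable lebesgue" for a b
    unfolding F_def using f by (rule weighted_integrand_measurable)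
  have shift: "(\<integral>\<^sup>+x. G x \<partial>lebesgue) = (\<integral>\<^sup>+x. G (x + s) \<partial>lebesgue)"
    if "G \<in> borel_measurable lebesgue" for G :: "real \<Rightarrow> ennreal" and s
    using nn_integral_real_affine_lebesgue[OF that, of 1 s] by (simp add: add.commute)
  have "(\<integral>\<^sup>+x. F (x + t) * indicator {0..<2*pi} x \<partial>lebesgue) =
        (\<integral>\<^sup>+x. F x * indicator {t..<2*pi+t} x \<partial>lebesgue)"
    using shift[OF meas[of t "2 * pi + t"], of t]
    by (simp add: indicator_def)
  also have "\<dots> = (\<integral>\<^sup>+x. F x * indicator {t..<2*pi} x + F x * indicator {2*pi..<2*pi+t} x \<partial>lebesgue)"
    using t by (intro nn_integral_cong) (auto simp: indicator_def)
  also have "\<dots> = (\<integral>\<^sup>+x. F x * indicator {t..<2*pi} x \<partial>lebesgue) +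
                  (\<integral>\<^sup>+x. F x * indicator {2*pi..<2*pi+t} x \<partial>lebesgue)"
    by (rule nn_integral_add[OF meas meas])
  also have "(\<integral>\<^sup>+x. F x * indicator {2*pi..<2*pi+t} x \<partial>lebesgue) =
             (\<integral>\<^sup>+x. F x * indicator {0..<t} x \<partial>lebesgue)"
    using shift[OF meas[of "2 * pi" "2 * pi + t"], of "2 * pi"]
    by (simp add: indicator_def per add.commute)
  also have "(\<integral>\<^sup>+x. F x * indicator {t..<2*pi} x \<partial>lebesgue) + \<dots> =
             (\<integral>\<^sup>+x. F x * indicator {t..<2*pi} x + F x * indicator {0..<t} x \<partial>lebesgue)"
    by (rule nn_integral_add[OF meas meas, symmetric])
  also have "\<dots> = (\<integral>\<^sup>+x. F x * indicator {0..<2*pi} x \<partial>lebesgue)"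
    using t by (intro nn_integral_cong) (auto simp: indicator_def)
  finally show ?thesis by (simp add: mean_powr_def F_def)
qed

lemma qnorm_translate:
  assumes f: "torus_fun f" and t: "0 \<le> t" "t < 2 * pi"
  shows "qnorm p (\<lambda>x. f (x + t)) = qnorm p f"
proof (cases "p = \<infinity>")
  case True
  have "range (\<lambda>x. ennreal (norm (f (x + t)))) = range (\<lambda>x. ennreal (norm (f x)))"
    by (auto intro: range_eqI[of _ _ "_ - t"])
  with True show ?thesis by (simp add: qnorm_def Lp_norm_def)
next
  case False
  with mean_powr_translate[OF assms] show ?thesis
    by (simp add: qnorm_def Lp_norm_finite_exponent)
qed

lemma Lp_norm_cmult:
  assumes "0 < p" "torus_fun f"
  shows "Lp_norm p (\<lambda>x. c * f x) = ennreal (norm c) * Lp_norm p f"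
proof (cases "p = \<infinity>")
  case True
  then show ?thesis
    by (simp add: Lp_norm_def norm_mult ennreal_mult SUP_mult_left_ennreal)
next
  case False
  define P where "P = enn2real p"
  have P: "0 < P" using assms False by (auto simp: P_def enn2real_positive_iff less_top)
  have "mean_powr P (\<lambda>x. c * f x) = ennreal (1 / (2 * pi)) *
     (\<integral>\<^sup>+ x. ennreal (norm c powr P) * (ennreal (norm (f x) powr P) * indicator {0..<2*pi} x) \<partial>lebesgue)"
    by (simp add: mean_powr_def norm_mult powr_mult ennreal_mult mult.assoc)
  also have "\<dots> = ennreal (1 / (2 * pi)) * (ennreal (norm c powr P) *
     (\<integral>\<^sup>+ x. (ennreal (norm (f x) powr P) * indicator {0..<2*pi} x) \<partial>lebesgue))"
    by (subst nn_integral_cmult) (auto intro!: weighted_integrand_measurable assms)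
  finally have "mean_powr P (\<lambda>x. c * f x) = ennreal (norm c powr P) * mean_powr P f"
    by (simp add: mean_powr_def mult_ac)
  with False P show ?thesis
    by (simp add: Lp_norm_finite_exponent P_def[symmetric] ennreal_powr_mult ennreal_powr_ennreal powr_powr)
qed

lemma qnorm_cmult:
  assumes "0 < p" "torus_fun f"
  shows "qnorm p (\<lambda>x. c * f x) = ennreal (norm c powr enn2real (min p 1)) * qnorm p f"
  using assms min_one_exponent[OF assms(1)]
  by (simp add: qnorm_def Lp_norm_cmult ennreal_powr_mult ennreal_powr_ennreal)

lemma mean_powr_add_le:
  assumes f: "torus_fun f" and g: "torus_fun g" and A: "0 \<le> A" and B: "0 \<le> B"
    and le: "\<And>x. norm (f x + g x) powr P \<le> A * norm (f x) powr P + B * norm (g x) powr P"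
  shows "mean_powr P (\<lambda>x. f x + g x) \<le> ennreal A * mean_powr P f + ennreal B * mean_powr P g"
proof -
  note meas = weighted_integrand_measurable[OF f, of P 0 "2 * pi"]
      weighted_integrand_measurable[OF g, of P 0 "2 * pi"]
  have "(\<integral>\<^sup>+ x \<in> {0..<2 * pi}. ennreal (norm (f x + g x) powr P) \<partial>lebesgue) \<le>
    (\<integral>\<^sup>+ x. ennreal A * (ennreal (norm (f x) powr P) * indicator {0..<2*pi} x) +
            ennreal B * (ennreal (norm (g x) powr P) * indicator {0..<2*pi} x) \<partial>lebesgue)"
    using le A B by (intro nn_integral_mono)
      (auto simp: indicator_def ennreal_mult[symmetric] ennreal_plus[symmetric]
          simp del: ennreal_plus intro!: ennreal_leI)
  also have "\<dots> = ennreal A * (\<integral>\<^sup>+ x. ennreal (norm (f x) powr P) * indicator {0..<2*pi} x \<partial>lebesgue) +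
      ennreal B * (\<integral>\<^sup>+ x. ennreal (norm (g x) powr P) * indicator {0..<2*pi} x \<partial>lebesgue)"
    using meas by (subst nn_integral_add) (auto simp: nn_integral_cmult)
  finally have "ennreal (1 / (2 * pi)) * (\<integral>\<^sup>+ x \<in> {0..<2 * pi}. ennreal (norm (f x
      + g x) powr P) \<partial>lebesgue)
      \<le> ennreal (1 / (2 * pi)) * \<dots>"
    by (rule mult_left_mono) simp
  then show ?thesis
    by (simp add: mean_powr_def distrib_left mult.left_commute)
qed

text \<open>
  For \<open>P \<le> 1\<close> this is the subadditivity of \<open>x powr P\<close>, for \<open>P > 1\<close> it is Minkowski's inequality.
\<close>

lemma qnorm_add:
  assumes p: "0 < p" and f: "torus_fun f" and g: "torus_fun g"
  shows "qnorm p (\<lambda>x. f x + g x) \<le> qnorm p f + qnorm p g"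
proof (cases "p = \<infinity>")
  case True
  have "(SUP x. ennreal (norm (f x + g x))) \<le> (SUP x. ennreal (norm (f x)))
      + (SUP x. ennreal (norm (g x)))"
  proof (rule SUP_least)
    fix x
    have "ennreal (norm (f x + g x)) \<le> ennreal (norm (f x)) + ennreal (norm (g x))"
      by (simp add: ennreal_plus[symmetric] norm_triangle_ineq ennreal_leI del: ennreal_plus)
    also have "\<dots> \<le> (SUP x. ennreal (norm (f x))) + (SUP x. ennreal (norm (g x)))"
      by (intro add_mono SUP_upper) auto
    finally show "ennreal (norm (f x + g x)) \<le> \<dots>" .
  qed
  with True show ?thesis by (simp add: qnorm_def Lp_norm_def)
next
  case False
  define P where "P = enn2real p"
  have P: "0 < P" "p = ennreal P" using p False by (auto simp: P_def enn2real_positive_iff less_top)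
  show ?thesis
  proof (cases "P \<le> 1")
    case True
    then have "enn2real (min p 1) = P" using P by (simp add: min_def)
    then have qn: "qnorm p h = mean_powr P h" for h
      using False P by (simp add: qnorm_def Lp_norm_finite_exponent ennreal_powr_powr)
    have "norm (f x + g x) powr P \<le> 1 * norm (f x) powr P + 1 * norm (g x) powr P" for x
    proof -
      have "norm (f x + g x) powr P \<le> (norm (f x) + norm (g x)) powr P"
        using P by (intro powr_mono2 norm_triangle_ineq) auto
      also have "\<dots> \<le> norm (f x) powr P + norm (g x) powr P"
        using P True by (intro powr_add_le_add_powr) auto
      finally show ?thesis by simp
    qed
    from mean_powr_add_le[OF f g _ _ this] show ?thesis by (simp add: qn)
  next
    case gt1: False
    then have "enn2real (min p 1) = 1" using P by (simp add: min_def)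
    then have qn: "qnorm p h = ennreal_powr (mean_powr P h) (1 / P)" for h
      using False P by (simp add: qnorm_def Lp_norm_finite_exponent)
    have bound: "qnorm p (\<lambda>x. f x + g x) \<le> ennreal (a + b)"
      if a: "0 < a" "qnorm p f \<le> ennreal a" and b: "0 < b" "qnorm p g \<le> ennreal b" for a b
    proof -
      have mf: "mean_powr P f \<le> ennreal (a powr P)" "mean_powr P g \<le> ennreal (b powr P)"
        using ennreal_powr_le_imp_le[of "mean_powr P f" "1 / P" a]
          ennreal_powr_le_imp_le[of "mean_powr P g" "1 / P" b] a b P(1) unfolding qn by auto
      define A B where "A = (a + b) powr (P - 1) * a powr (1 - P)"
        and "B = (a + b) powr (P - 1) * b powr (1 - P)"
      have "norm (f x + g x) powr P \<le> A * norm (f x) powr P + B * norm (g x) powr P" for x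
      proof -
        have "norm (f x + g x) powr P \<le> (norm (f x) + norm (g x)) powr P"
          using P by (intro powr_mono2 norm_triangle_ineq) auto
        also have "\<dots> \<le> A * norm (f x) powr P + B * norm (g x) powr P"
          using powr_add_le_weighted[of "norm (f x)" "norm (g x)" a b P] a b gt1
          by (simp add: A_def B_def algebra_simps)
        finally show ?thesis .
      qed
      then have "mean_powr P (\<lambda>x. f x + g x) \<le> ennreal A * mean_powr P f + ennreal B * mean_powr P g"
        by (intro mean_powr_add_le[OF f g]) (auto simp: A_def B_def)
      also have "\<dots> \<le> ennreal A * ennreal (a powr P) + ennreal B * ennreal (b powr P)"
        by (intro add_mono mult_left_mono mf) auto
      also have "\<dots> = ennreal (A * a powr P + B * b powr P)"
        by (simp add: A_def B_def ennreal_mult)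
      also have "A * a powr P + B * b powr P = (a + b) powr P"
      proof -
        have "A * a powr P = (a + b) powr (P - 1) * a" "B * b powr P = (a + b) powr (P - 1) * b"
          using a b by (auto simp: A_def B_def powr_add[symmetric])
        then show ?thesis
          using a b by (simp add: distrib_left[symmetric] powr_mult_base mult.commute[of _ "a + b"])
      qed
      finally have "ennreal_powr (mean_powr P (\<lambda>x. f x + g x)) (1 / P) \<le> ennreal_powr (ennreal ((a
          + b) powr P)) (1 / P)"
        using P by (intro ennreal_powr_mono) auto
      then show ?thesis
        using P(1) a(1) b(1) unfolding qn by (simp add: ennreal_powr_ennreal powr_powr)
    qed
    show ?thesis
    proof (rule ennreal_le_epsilon)
      fix e :: real assume fin: "qnorm p f + qnorm p g < top" and e: "0 < e"
      then obtain u v where uv: "qnorm p f = ennreal u" "0 \<le> u" "qnorm p g = ennreal v" "0 \<le> v"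
        by (cases "qnorm p f"; cases "qnorm p g") auto
      have "qnorm p (\<lambda>x. f x + g x) \<le> ennreal ((u + e / 2) + (v + e / 2))"
        using uv e by (intro bound) (auto intro!: ennreal_leI)
      also have "\<dots> = qnorm p f + qnorm p g + ennreal e"
        using uv e by (simp add: ennreal_plus[symmetric] del: ennreal_plus)
      finally show "qnorm p (\<lambda>x. f x + g x) \<le> qnorm p f + qnorm p g + ennreal e" .
    qed
  qed
qed

section \<open>Finite differences\<close>

text \<open>
  The first difference; by \<open>fdiff_Suc\<close> its iterates are the differences of higher order.
\<close>

definition diff_step :: "real \<Rightarrow> (real \<Rightarrow> complex) \<Rightarrow> real \<Rightarrow> complex" where
  "diff_step \<delta> f = (\<lambda>x. f x - f (x + \<delta>))"

lemma fdiff_0: "fdiff 0 \<delta> f = f"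
  by (simp add: fdiff_def)

lemma fdiff_Suc: "fdiff (Suc k) \<delta> f = diff_step \<delta> (fdiff k \<delta> f)"
proof
  fix x
  define a where "a \<nu> = (-1) ^ \<nu> * of_nat (k choose \<nu>) * f (x + real \<nu> * \<delta>)" for \<nu>
  define b where "b \<nu> = (-1) ^ \<nu> * of_nat (k choose \<nu>) * f (x + \<delta> + real \<nu> * \<delta>)" for \<nu>
  have "fdiff k \<delta> f x = (\<Sum>\<nu>=0..Suc k. a \<nu>)"
    by (simp add: fdiff_def a_def)
  also have "\<dots> = f x + (\<Sum>\<nu>=0..k. a (Suc \<nu>))"
    by (subst sum.atLeast0_atMost_Suc_shift) (simp add: a_def)
  finally have "fdiff k \<delta> f x - fdiff k \<delta> f (x + \<delta>) = f x + (\<Sum>\<nu>=0..k. a (Suc \<nu>) - b \<nu>)"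
    by (simp add: fdiff_def b_def sum_subtractf)
  also have "\<dots> = fdiff (Suc k) \<delta> f x"
    unfolding fdiff_def
    by (subst sum.atLeast0_atMost_Suc_shift) (auto simp: a_def b_def algebra_simps intro!: sum.cong)
  finally show "fdiff (Suc k) \<delta> f x = diff_step \<delta> (fdiff k \<delta> f) x"
    by (simp add: diff_step_def)
qed

lemma torus_fun_translate:
  assumes "torus_fun f" shows "torus_fun (\<lambda>x. f (x + t))"
proof -
  have "(\<lambda>x. t + (\<Sum>j\<in>Basis. (1 * (x \<bullet> j)) *\<^sub>R j)) \<in> lebesgue \<rightarrow>\<^sub>M (lebesgue :: real measure)"
    by (rule lebesgue_affine_measurable) auto
  then have "(\<lambda>x. x + t) \<in> lebesgue \<rightarrow>\<^sub>M (lebesgue :: real measure)"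
    by (simp add: add.commute)
  from measurable_compose[OF this, of f borel] assms show ?thesis
    by (simp add: torus_fun_def periodic_2pi_def) (metis add.commute add.left_commute)
qed

lemma torus_fun_add: "torus_fun f \<Longrightarrow> torus_fun g \<Longrightarrow> torus_fun (\<lambda>x. f x + g x)"
  by (auto simp: torus_fun_def periodic_2pi_def intro: borel_measurable_add)

lemma torus_fun_cmult: "torus_fun f \<Longrightarrow> torus_fun (\<lambda>x. c * f x)"
  by (auto simp: torus_fun_def periodic_2pi_def intro: borel_measurable_times)

lemma torus_fun_diff: "torus_fun f \<Longrightarrow> torus_fun g \<Longrightarrow> torus_fun (\<lambda>x. f x - g x)"
  by (auto simp: torus_fun_def periodic_2pi_def intro: borel_measurable_diff)

lemma torus_fun_diff_step: "torus_fun f \<Longrightarrow> torus_fun (diff_step \<delta> f)"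
  unfolding diff_step_def by (intro torus_fun_diff torus_fun_translate)

lemma torus_fun_fdiff: "torus_fun f \<Longrightarrow> torus_fun (fdiff k \<delta> f)"
  by (induction k) (auto simp: fdiff_0 fdiff_Suc intro: torus_fun_diff_step)

lemma torus_fun_sum:
  "finite A \<Longrightarrow> (\<And>i. i \<in> A \<Longrightarrow> torus_fun (f i)) \<Longrightarrow> torus_fun (\<lambda>x. \<Sum>i\<in>A. f i x)"
  by (induction A rule: finite_induct)
     (simp_all add: torus_fun_add, simp add: torus_fun_def periodic_2pi_def)

section \<open>Trigonometric polynomials\<close>

lemma trig_polysE:
  assumes "T \<in> trig_polys N"
  obtains c where "T = (\<lambda>x. \<Sum>\<nu>=- int N..int N. c \<nu> * cis (of_int \<nu> * x))"
proof -
  have "exp (\<i> * of_int \<nu> * of_real x) = cis (of_int \<nu> * x)" for \<nu> x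
    by (simp add: cis_conv_exp mult.assoc)
  with assms that show ?thesis by (auto simp: trig_polys_def)
qed

lemma trig_polysI: "(\<lambda>x. \<Sum>\<nu>=- int N..int N. c \<nu> * cis (of_int \<nu> * x)) \<in> trig_polys N"
proof -
  have "cis (of_int \<nu> * x) = exp (\<i> * of_int \<nu> * of_real x)" for \<nu> x
    by (simp add: cis_conv_exp mult.assoc)
  then show ?thesis by (auto simp: trig_polys_def)
qed

lemma trig_polys_diff:
  assumes "S \<in> trig_polys N" "T \<in> trig_polys N" shows "(\<lambda>x. S x - T x) \<in> trig_polys N"
proof -
  obtain c where S: "S = (\<lambda>x. \<Sum>\<nu>=- int N..int N. c \<nu> * cis (of_int \<nu> * x))"
    using assms(1) by (rule trig_polysE)
  obtain d where T: "T = (\<lambda>x. \<Sum>\<nu>=- int N..int N. d \<nu> * cis (of_int \<nu> * x))"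
    using assms(2) by (rule trig_polysE)
  from S T show ?thesis
    using trig_polysI[where N = N and c = "\<lambda>\<nu>. c \<nu> - d \<nu>"]
        by (simp add: sum_subtractf left_diff_distrib)
qed

lemma trig_polys_translate:
  assumes "T \<in> trig_polys N" shows "(\<lambda>x. T (x + t)) \<in> trig_polys N"
proof -
  obtain c where "T = (\<lambda>x. \<Sum>\<nu>=- int N..int N. c \<nu> * cis (of_int \<nu> * x))"
    using assms by (rule trig_polysE)
  then show ?thesis
    using trig_polysI[where N = N and c = "\<lambda>\<nu>. c \<nu> * cis (of_int \<nu> * t)"]
    by (simp add: distrib_left cis_mult[symmetric] mult_ac)
qed

lemma trig_polys_fdiff: "T \<in> trig_polys N \<Longrightarrow> fdiff k \<delta> T \<in> trig_polys N"
proof (induction k)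
  case (Suc k)
  then show ?case
    unfolding fdiff_Suc diff_step_def by (intro trig_polys_diff trig_polys_translate) auto
qed (simp add: fdiff_0)

lemma trig_polys_mono:
  assumes "N \<le> M" shows "trig_polys N \<subseteq> trig_polys M"
proof
  fix T assume "T \<in> trig_polys N"
  then obtain c where T: "T = (\<lambda>x. \<Sum>\<nu>=- int N..int N. c \<nu> * cis (of_int \<nu> * x))"
    by (rule trig_polysE)
  have "T = (\<lambda>x. \<Sum>\<nu>=- int M..int M. (if \<bar>\<nu>\<bar> \<le> int N then c \<nu> else 0) * cis (of_int \<nu> * x))"
    unfolding T by (intro ext sum.mono_neutral_cong_left) (use assms in auto)
  then show "T \<in> trig_polys M" using trig_polysI by auto
qed

lemma torus_fun_trig_poly:
  assumes "T \<in> trig_polys N" shows "torus_fun T"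
proof -
  obtain c where T: "T = (\<lambda>x. \<Sum>\<nu>=- int N..int N. c \<nu> * cis (of_int \<nu> * x))"
    using assms by (rule trig_polysE)
  have "torus_fun (\<lambda>x. cis (of_int \<nu> * x))" for \<nu>
  proof -
    have "continuous_on UNIV (\<lambda>x. cis (of_int \<nu> * x))" by (intro continuous_intros)
    then have "(\<lambda>x. cis (of_int \<nu> * x)) \<in> borel_measurable lebesgue"
      by (intro measurable_completion) (simp add: borel_measurable_continuous_onI)
    moreover have "cis (of_int \<nu> * (x + 2 * pi)) = cis (of_int \<nu> * x)" for x
      using cis_multiple_2pi[of "of_int \<nu>"]
      by (simp add: distrib_left cis_mult[symmetric] mult_ac)
    ultimately show ?thesis by (simp add: torus_fun_def periodic_2pi_def)
  qed
  then show ?thesis unfolding T by (intro torus_fun_sum torus_fun_cmult) auto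
qed

lemma trig_poly_eq_poly:
  assumes "T \<in> trig_polys N"
  obtains P where "degree P \<le> 2 * N" "\<And>x. T x = cis (- (real N * x)) * poly P (cis x)"
proof -
  obtain c where T: "T = (\<lambda>x. \<Sum>\<nu>=- int N..int N. c \<nu> * cis (of_int \<nu> * x))"
    using assms by (rule trig_polysE)
  define P where "P = (\<Sum>i\<le>2*N. monom (c (int i - int N)) i)"
  have "degree P \<le> 2 * N"
    unfolding P_def by (intro degree_sum_le) (auto intro: order.trans[OF degree_monom_le])
  moreover have "T x = cis (- (real N * x)) * poly P (cis x)" for x
  proof -
    have "T x = (\<Sum>i\<le>2*N. c (int i - int N) * cis (of_int (int i - int N) * x))"
      unfolding T
      by (rule sum.reindex_bij_witness[of _ "\<lambda>i. int i - int N" "\<lambda>\<nu>. nat (\<nu> + int N)"]) auto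
    also have "\<dots> = (\<Sum>i\<le>2*N. cis (- (real N * x)) * (c (int i - int N) * cis x ^ i))"
      by (intro sum.cong) (auto simp: Complex.DeMoivre cis_mult left_diff_distrib)
    also have "\<dots> = cis (- (real N * x)) * poly P (cis x)"
      by (simp add: P_def poly_sum poly_monom sum_distrib_left)
    finally show ?thesis .
  qed
  ultimately show ?thesis using that by blast
qed

section \<open>Interpolation with a localized kernel\<close>

lemma sum_roots_of_unity:
  fixes i m M :: nat
  assumes "i < M" "m < M"
  shows "(\<Sum>j<M. cis ((real i - real m) * (x + 2 * pi * real j / real M))) = (if i
      = m then of_nat M else 0)"
proof (cases "i = m")
  case False
  define d where "d = real i - real m"
  define \<zeta> where "\<zeta> = cis (2 * pi * d / real M)"
  have M: "0 < M" using assms by simp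
  have "\<zeta> \<noteq> 1"
  proof
    assume "\<zeta> = 1"
    then have "cos (2 * pi * d / real M) = 1" by (simp add: \<zeta>_def complex_eq_iff)
    then obtain k :: int where "2 * pi * d / real M = of_int k * (2 * pi)"
      unfolding cos_one_2pi_int by (auto simp: mult.assoc)
    then have "d = of_int k * real M" using M by (simp add: field_simps)
    then have "real_of_int (int i - int m) = real_of_int (k * int M)" by (simp add: d_def)
    then have "int i - int m = k * int M" by (simp only: of_int_eq_iff)
    moreover have "\<bar>int i - int m\<bar> < int M" "int i - int m \<noteq> 0" using assms False by auto
    ultimately show False
      by (metis abs_mult abs_of_nat dvd_triv_right zdvd_imp_le abs_ge_zero not_le dvd_abs_iff zero_less_abs_iff)
  qed
  have "\<zeta> ^ M = 1"
  proof -
    have "\<zeta> ^ M = cis (2 * pi * of_int (int i - int m))"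
      using M by (simp add: \<zeta>_def Complex.DeMoivre d_def)
    also have "\<dots> = 1" by (intro cis_multiple_2pi) auto
    finally show ?thesis .
  qed
  have "cis (d * (x + 2 * pi * real j / real M)) = cis (d * x) * \<zeta> ^ j" for j
    by (simp add: \<zeta>_def Complex.DeMoivre cis_mult algebra_simps)
  then have "(\<Sum>j<M. cis (d * (x + 2 * pi * real j / real M))) = cis (d * x) * (\<Sum>j<M. \<zeta> ^ j)"
    by (simp add: sum_distrib_left)
  also have "(\<Sum>j<M. \<zeta> ^ j) = 0"
    using \<open>\<zeta> \<noteq> 1\<close> \<open>\<zeta> ^ M = 1\<close> by (simp add: geometric_sum)
  finally show ?thesis using False by (simp add: d_def)
qed simp

text \<open>
  Lagrange interpolation of a polynomial at the \<open>M\<close>-th roots of unity rotated by \<open>cis x\<close>.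
\<close>

lemma poly_interpolation_roots_of_unity:
  assumes "degree P < M"
  shows "poly P w = (\<Sum>j<M. poly P (cis (x + 2 * pi * real j / real M)) *
           (\<Sum>m<M. (w / cis (x + 2 * pi * real j / real M)) ^ m)) / of_nat M"
proof -
  define u where "u j = x + 2 * pi * real j / real M" for j
  have M: "0 < M" using assms by simp
  have P: "poly P z = (\<Sum>i<M. coeff P i * z ^ i)" for z
    unfolding poly_altdef
    by (rule sum.mono_neutral_left) (use assms in \<open>auto simp: coeff_eq_0\<close>)
  have "(\<Sum>j<M. poly P (cis (u j)) * (\<Sum>m<M. (w / cis (u j)) ^ m)) =
        (\<Sum>j<M. \<Sum>i<M. \<Sum>m<M. coeff P i * w ^ m * cis ((real i - real m) * u j))"
  proof (intro sum.cong refl)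
    fix j
    have "cis (u j) ^ i * (w / cis (u j)) ^ m = w ^ m * cis ((real i - real m) * u j)" for i m
      by (simp add: power_divide Complex.DeMoivre cis_divide[symmetric] left_diff_distrib)
    then show "poly P (cis (u j)) * (\<Sum>m<M. (w / cis (u j)) ^ m) =
        (\<Sum>i<M. \<Sum>m<M. coeff P i * w ^ m * cis ((real i - real m) * u j))"
      by (simp add: P sum_product mult.assoc)
  qed
  also have "\<dots> = (\<Sum>i<M. \<Sum>j<M. \<Sum>m<M. coeff P i * w ^ m * cis ((real i - real m) * u j))"
    by (rule sum.swap)
  also have "\<dots> = (\<Sum>i<M. \<Sum>m<M. \<Sum>j<M. coeff P i * w ^ m * cis ((real i - real m) * u j))"
    by (rule sum.cong[OF refl], rule sum.swap)
  also have "\<dots> = (\<Sum>i<M. \<Sum>m<M. coeff P i * w ^ m * (\<Sum>j<M. cis ((real i - real m) * u j)))"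
    by (simp add: sum_distrib_left)
  also have "\<dots> = (\<Sum>i<M. \<Sum>m<M. if m = i then coeff P i * w ^ i * of_nat M else 0)"
    unfolding u_def by (intro sum.cong refl) (simp add: sum_roots_of_unity)
  also have "\<dots> = poly P w * of_nat M"
    by (simp add: P sum_distrib_right)
  finally show ?thesis using M by (simp add: u_def)
qed

text \<open>
  The mean of the first \<open>N\<close> exponentials: it equals 1 at 0, and at distance \<open>d\<close> from the
  multiples of \<open>2 * pi\<close> it is of size at most a constant times \<open>1 / (N * d)\<close>.
\<close>

definition exp_mean :: "nat \<Rightarrow> real \<Rightarrow> complex" where
  "exp_mean N t = (\<Sum>i<N. cis (real i * t)) / of_nat N"

text \<open>
  A Dirichlet type kernel with \<open>M\<close> frequencies, localized by the factor \<open>exp_mean N t ^ s\<close>.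
  The larger \<open>s\<close> is, the faster the kernel decays away from 0.
\<close>

definition interp_kernel :: "nat \<Rightarrow> nat \<Rightarrow> nat \<Rightarrow> real \<Rightarrow> complex" where
  "interp_kernel s N M t = (\<Sum>m<M. cis ((real N - real m) * t)) * exp_mean N t ^ s / of_nat M"

text \<open>
  Localization costs nothing: as \<open>exp_mean N\<close> is 1 at 0, interpolating the product
  \<open>T u * exp_mean N (u - y) ^ s\<close> and evaluating it at \<open>u = y\<close> recovers \<open>T y\<close>. The hypothesis on
  \<open>M\<close> makes the number of nodes exceed the degree of this product.
\<close>

lemma trig_poly_interpolation:
  assumes T: "T \<in> trig_polys N" and N: "1 \<le> N" and M: "(s + 2) * N < M"
  shows "T y = (\<Sum>j<M. T (x + 2 * pi * real j / real M) *
                        interp_kernel s N M (x + 2 * pi * real j / real M - y))"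
proof -
  define u where "u j = x + 2 * pi * real j / real M" for j
  obtain P where P: "degree P \<le> 2 * N" "\<And>x. T x = cis (- (real N * x)) * poly P (cis x)"
    using trig_poly_eq_poly[OF T] by metis
  define G where "G = (\<Sum>i<N. monom (cis (- (real i * y)) / of_nat N) i)"
  have G: "poly G (cis v) = exp_mean N (v - y)" for v
    by (simp add: G_def poly_sum poly_monom exp_mean_def sum_divide_distrib Complex.DeMoivre cis_mult right_diff_distrib)
  have "degree G \<le> N"
    unfolding G_def by (intro degree_sum_le) (auto intro: order.trans[OF degree_monom_le])
  then have "degree (G ^ s) \<le> N * s"
    by (metis degree_power_le mult_le_mono1 order.trans)
  with P(1) have "degree (P * G ^ s) \<le> 2 * N + N * s"
    using degree_mult_le[of P "G ^ s"] by linarith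
  with M have deg: "degree (P * G ^ s) < M" by (simp add: algebra_simps)
  have G1: "poly G (cis y) = 1" using N by (simp add: G exp_mean_def)
  have "T y = cis (- (real N * y)) * poly (P * G ^ s) (cis y)"
    by (simp add: P(2) G1)
  also have "\<dots> = (\<Sum>j<M. cis (- (real N * y)) * (poly P (cis (u j)) * exp_mean N (u j - y) ^ s *
           (\<Sum>m<M. (cis y / cis (u j)) ^ m)) / of_nat M)"
    by (subst poly_interpolation_roots_of_unity[OF deg, of _ x])
       (simp add: u_def[symmetric] G sum_distrib_left sum_divide_distrib)
  also have "\<dots> = (\<Sum>j<M. T (u j) * interp_kernel s N M (u j - y))"
  proof (intro sum.cong refl)
    fix j
    have "cis (- (real N * y)) * (\<Sum>m<M. (cis y / cis (u j)) ^ m) =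
        cis (- (real N * u j)) * (\<Sum>m<M. cis ((real N - real m) * (u j - y)))"
      unfolding sum_distrib_left
      by (intro sum.cong refl) (simp add: cis_divide Complex.DeMoivre cis_mult algebra_simps)
    then show "cis (- (real N * y)) * (poly P (cis (u j)) * exp_mean N (u j - y) ^ s *
           (\<Sum>m<M. (cis y / cis (u j)) ^ m)) / of_nat M = T (u j) * interp_kernel s N M (u j - y)"
      by (simp add: P(2) interp_kernel_def mult_ac)
  qed
  finally show ?thesis by (simp add: u_def)
qed

section \<open>Bounds for the kernel\<close>

lemma norm_cis_diff_le: "norm (cis a - cis b) \<le> \<bar>a - b\<bar>"
proof -
  have "cis a - cis b = cis b * (cis (a - b) - 1)"
    by (simp add: right_diff_distrib cis_mult)
  then have "norm (cis a - cis b) = norm (exp (\<i> * of_real (a - b)) - 1)"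
    by (simp add: norm_mult cis_conv_exp)
  also have "\<dots> = 2 * \<bar>sin ((a - b) / 2)\<bar>" by (rule dist_exp_i_1)
  also have "\<dots> \<le> \<bar>a - b\<bar>" using abs_sin_x_le_abs_x[of "(a - b) / 2"] by simp
  finally show ?thesis .
qed

lemma norm_exp_mean_le: "norm (exp_mean N t) \<le> 1"
proof (cases "N = 0")
  case False
  have "norm (\<Sum>i<N. cis (real i * t)) \<le> (\<Sum>i<N. 1)"
    by (rule sum_norm_le) simp
  with False show ?thesis by (simp add: exp_mean_def norm_divide)
qed (simp add: exp_mean_def)

lemma exp_mean_lipschitz: "norm (exp_mean N a - exp_mean N b) \<le> real N * \<bar>a - b\<bar>"
proof (cases "N = 0")
  case False
  have "norm (\<Sum>i<N. cis (real i * a) - cis (real i * b)) \<le> (\<Sum>i<N. real N * \<bar>a - b\<bar>)"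
  proof (rule sum_norm_le)
    fix i assume "i \<in> {..<N}"
    have "norm (cis (real i * a) - cis (real i * b)) \<le> real i * \<bar>a - b\<bar>"
      using norm_cis_diff_le[of "real i * a" "real i * b"]
      by (simp add: right_diff_distrib[symmetric] abs_mult)
    also have "\<dots> \<le> real N * \<bar>a - b\<bar>" using \<open>i \<in> _\<close> by (intro mult_right_mono) auto
    finally show "norm (cis (real i * a) - cis (real i * b)) \<le> real N * \<bar>a - b\<bar>" .
  qed
  with False show ?thesis
    by (simp add: exp_mean_def norm_divide sum_subtractf diff_divide_distrib[symmetric] field_simps)
qed (simp add: exp_mean_def)

lemma exp_mean_decay: "real N * norm (cis t - 1) * norm (exp_mean N t) \<le> 2"
proof (cases "N = 0")
  case False
  have "(cis t - 1) * (\<Sum>i<N. cis t ^ i) = cis t ^ N - 1"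
    by (rule power_diff_1_eq[symmetric])
  then have "norm ((cis t - 1) * (\<Sum>i<N. cis (real i * t))) = norm (cis (real N * t) - 1)"
    by (simp add: Complex.DeMoivre)
  also have "\<dots> \<le> 2" using norm_triangle_ineq4[of "cis (real N * t)" 1] by simp
  finally show ?thesis using False by (simp add: exp_mean_def norm_divide norm_mult)
qed simp

lemma norm_power_diff_le:
  fixes a b :: complex
  assumes "norm a \<le> g" "norm b \<le> g"
  shows "norm (a ^ Suc l - b ^ Suc l) \<le> real (Suc l) * norm (a - b) * g ^ l"
proof (induction l)
  case (Suc l)
  have g: "0 \<le> g" using assms norm_ge_zero order.trans by blast
  have "a ^ Suc (Suc l) - b ^ Suc (Suc l) = a * (a ^ Suc l - b ^ Suc l) + (a - b) * b ^ Suc l"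
    by (simp add: algebra_simps)
  also have "norm \<dots> \<le> norm a * norm (a ^ Suc l - b ^ Suc l) + norm (a - b) * norm b ^ Suc l"
    by (metis norm_triangle_ineq norm_mult norm_power)
  also have "\<dots> \<le> g * (real (Suc l) * norm (a - b) * g ^ l) + norm (a - b) * g ^ Suc l"
    using assms g Suc.IH by (intro add_mono mult_mono power_mono) auto
  finally show ?case by (simp add: algebra_simps)
qed simp

lemma sin_ge_half:
  fixes x :: real assumes "0 \<le> x" "x \<le> pi / 2" shows "x / 2 \<le> sin x"
proof -
  have cos_ge: "sqrt 2 / 2 \<le> cos y" if "0 \<le> y" "y \<le> pi / 4" for y
    using cos_monotone_0_pi_le[of y "pi / 4"] that by (simp add: cos_45)
  define y where "y = x / 2"
  have y: "0 \<le> y" "y \<le> pi / 4" using assms by (auto simp: y_def)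
  have "y * (sqrt 2 / 2) \<le> sin y"
  proof (cases "y = 0")
    case False
    then obtain z where "0 < z" "z < y" "sin y - sin 0 = (y - 0) * cos z"
      using MVT2[of 0 y sin cos] y by auto
    then show ?thesis using cos_ge[of z] y by (simp add: mult_left_mono)
  qed simp
  then have "(y * (sqrt 2 / 2)) * (sqrt 2 / 2) \<le> sin y * cos y"
    using cos_ge[OF y] y sin_ge_zero[of y] by (intro mult_mono) auto
  moreover have "sin x = 2 * (sin y * cos y)"
    using sin_double[of y] by (simp add: y_def)
  moreover have "(y * (sqrt 2 / 2)) * (sqrt 2 / 2) = x / 4"
    by (simp add: y_def mult.assoc)
  ultimately show ?thesis by linarith
qed

lemma norm_root_of_unity_minus_1_ge:
  assumes "0 < j" "j < M"
  shows "real (min j (M - j)) / real M \<le> norm (cis (2 * pi * real j / real M) - 1)"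
proof -
  define d where "d = min j (M - j)"
  define \<theta> where "\<theta> = pi * (real d / real M)"
  have "norm (cis (2 * pi * real j / real M) - 1) = 2 * \<bar>sin (pi * real j / real M)\<bar>"
    using dist_exp_i_1[of "2 * pi * real j / real M"] by (simp add: cis_conv_exp)
  also have "sin (pi * real j / real M) = sin \<theta>"
  proof (cases "j \<le> M - j")
    case False
    then have "\<theta> = pi - pi * real j / real M"
      using assms by (simp add: d_def \<theta>_def of_nat_diff field_simps)
    then show ?thesis by simp
  qed (simp add: d_def \<theta>_def)
  finally have norm_eq: "norm (cis (2 * pi * real j / real M) - 1) = 2 * \<bar>sin \<theta>\<bar>" .
  have "\<theta> / 2 \<le> sin \<theta>"
  proof (rule sin_ge_half)
    have "2 * real d \<le> real M" using assms by (simp add: d_def)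
    then show "\<theta> \<le> pi / 2" using assms by (simp add: \<theta>_def field_simps)
  qed (simp add: \<theta>_def)
  moreover have "real d / real M \<le> \<theta>"
    using pi_ge_two mult_right_mono[of 1 pi "real d / real M"] by (simp add: \<theta>_def)
  ultimately show ?thesis
    unfolding norm_eq d_def[symmetric] by linarith
qed

lemma interp_kernel_lipschitz:
  assumes a: "norm (exp_mean N a) \<le> g" and b: "norm (exp_mean N b) \<le> g" and g: "g \<le> 1"
    and N: "0 < N" "N \<le> M"
  shows "norm (interp_kernel (Suc l) N M a - interp_kernel (Suc l) N M b)
           \<le> (real M + real (Suc l) * real N) * \<bar>a - b\<bar> * g ^ l"
proof -
  define D where "D t = (\<Sum>m<M. cis ((real N - real m) * t))" for t
  define G where "G = exp_mean N"
  have g0: "0 \<le> g" using a norm_ge_zero order.trans by blast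
  have Db: "norm (D b) \<le> real M"
    unfolding D_def by (rule order.trans[OF sum_norm_le[of _ _ "\<lambda>_. 1"]]) auto
  have DD: "norm (D a - D b) \<le> real M * (real M * \<bar>a - b\<bar>)"
  proof -
    have "norm (\<Sum>m<M. cis ((real N - real m) * a) - cis ((real N - real m) * b))
        \<le> (\<Sum>m<M. real M * \<bar>a - b\<bar>)"
    proof (rule sum_norm_le)
      fix m assume "m \<in> {..<M}"
      have "norm (cis ((real N - real m) * a) - cis ((real N - real m) * b))
          \<le> \<bar>real N - real m\<bar> * \<bar>a - b\<bar>"
        using norm_cis_diff_le[of "(real N - real m) * a" "(real N - real m) * b"]
        by (simp add: right_diff_distrib[symmetric] abs_mult)
      also have "\<dots> \<le> real M * \<bar>a - b\<bar>" using \<open>m \<in> _\<close> N by (intro mult_right_mono) auto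
      finally show "norm (cis ((real N - real m) * a) - cis ((real N - real m) * b))
          \<le> real M * \<bar>a - b\<bar>" .
    qed
    then show ?thesis by (simp add: D_def sum_subtractf)
  qed
  have "D a * G a ^ Suc l - D b * G b ^ Suc l
      = (D a - D b) * G a ^ Suc l + D b * (G a ^ Suc l - G b ^ Suc l)"
    by (simp add: algebra_simps)
  also have "norm \<dots> \<le> norm (D a - D b) * norm (G a) ^ Suc l
      + norm (D b) * norm (G a ^ Suc l - G b ^ Suc l)"
    by (metis norm_triangle_ineq norm_mult norm_power)
  also have "\<dots> \<le> real M * (real M * \<bar>a - b\<bar>) * g ^ l
      + real M * (real (Suc l) * (real N * \<bar>a - b\<bar>) * g ^ l)"
  proof (intro add_mono mult_mono DD Db)
    have "norm (G a) ^ Suc l \<le> g ^ Suc l" using a by (intro power_mono) (auto simp: G_def)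
    also have "\<dots> \<le> g ^ l" using g g0 by (intro power_decreasing) auto
    finally show "norm (G a) ^ Suc l \<le> g ^ l" .
    have "norm (G a ^ Suc l - G b ^ Suc l) \<le> real (Suc l) * norm (G a - G b) * g ^ l"
      using a b unfolding G_def by (rule norm_power_diff_le)
    also have "\<dots> \<le> real (Suc l) * (real N * \<bar>a - b\<bar>) * g ^ l"
      using exp_mean_lipschitz g0 unfolding G_def by (intro mult_right_mono mult_left_mono) auto
    finally show "norm (G a ^ Suc l - G b ^ Suc l) \<le> real (Suc l) * (real N * \<bar>a - b\<bar>) * g ^ l" .
  qed auto
  also have "\<dots> = real M * ((real M + real (Suc l) * real N) * \<bar>a - b\<bar> * g ^ l)"
    by (simp add: algebra_simps)
  finally have "norm (D a * G a ^ Suc l - D b * G b ^ Suc l) \<le> \<dots>" .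
  moreover have "interp_kernel (Suc l) N M a - interp_kernel (Suc l) N M b
      = (D a * G a ^ Suc l - D b * G b ^ Suc l) / of_nat M"
    by (simp add: interp_kernel_def D_def G_def diff_divide_distrib)
  ultimately show ?thesis
    using N by (simp add: norm_divide divide_le_eq mult.commute[of _ "real M"] del: power_Suc)
qed

text \<open>
  A shift of the node by \<open>\<delta> \<le> 1 / N\<close> moves the point by no more than the scale \<open>1 / N\<close> of
  \<open>exp_mean N\<close>, hence it does not affect the order of the bound.
\<close>

lemma exp_mean_node_le:
  fixes l N j :: nat and \<delta> :: real
  defines "M \<equiv> (l + 4) * N"
  assumes N: "0 < N" and \<delta>: "0 < \<delta>" "\<delta> * real N \<le> 1" and j: "0 < j" "j < M"
    and t: "t = 2 * pi * real j / real M" and v: "v = t \<or> v = t - \<delta>"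
  shows "norm (exp_mean N v) \<le> min 1 (3 * real (l + 4) / real (min j (M - j)))"
proof -
  define d where "d = real (min j (M - j))"
  have d: "0 < d" using j by (simp add: d_def)
  define g where "g = norm (exp_mean N v)"
  have g: "0 \<le> g" "g \<le> 1" using norm_exp_mean_le by (auto simp: g_def)
  have "d / real M \<le> norm (cis t - 1)"
    using norm_root_of_unity_minus_1_ge[OF j] by (simp add: d_def t)
  also have "norm (cis t - 1) \<le> norm (cis v - 1) + \<delta>"
  proof -
    have "norm (cis t - 1) \<le> norm (cis t - cis v) + norm (cis v - 1)"
      using norm_triangle_ineq[of "cis t - cis v" "cis v - 1"] by simp
    moreover have "norm (cis t - cis v) \<le> \<delta>"
      using norm_cis_diff_le[of t v] v \<delta> by auto
    ultimately show ?thesis by simp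
  qed
  finally have "real N * (d / real M) \<le> real N * (norm (cis v - 1) + \<delta>)"
    by (intro mult_left_mono) auto
  moreover have "real N * (d / real M) = d / real (l + 4)"
    using N by (simp add: M_def)
  moreover have "real N * (norm (cis v - 1) + \<delta>) \<le> real N * norm (cis v - 1) + 1"
    using \<delta> by (simp add: distrib_left mult.commute)
  ultimately have "d / real (l + 4) \<le> real N * norm (cis v - 1) + 1" by linarith
  then have "d / real (l + 4) * g \<le> (real N * norm (cis v - 1) + 1) * g"
    using g by (intro mult_right_mono) auto
  also have "\<dots> \<le> 3"
    using exp_mean_decay[of N v] g by (simp add: g_def algebra_simps)
  finally have "g \<le> 3 * real (l + 4) / d" using d by (simp add: field_simps)
  with g show ?thesis by (simp add: g_def d_def)
qed

lemma sum_inverse_squares_le: "(\<Sum>j=1..n. 1 / real j ^ 2) \<le> 2"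
proof -
  \<comment> \<open>For \<open>n = 0\<close> the bound is 2, since \<open>1 / 0 = 0\<close>.\<close>
  have "(\<Sum>j=1..n. 1 / real j ^ 2) \<le> 2 - 1 / real n"
  proof (induction n)
    case (Suc n)
    show ?case
    proof (cases "n = 0")
      case False
      have "1 / real (Suc n) ^ 2 \<le> 1 / (real n * real (Suc n))"
        using False by (intro divide_left_mono) (auto simp: power2_eq_square)
      also have "\<dots> = 1 / real n - 1 / real (Suc n)"
        using False by (simp add: field_simps)
      finally show ?thesis using Suc by simp
    qed simp
  qed simp
  also have "\<dots> \<le> 2" by simp
  finally show ?thesis .
qed

text \<open>
  The exponent \<open>l\<close> is so large that the \<open>q\<close>-th powers of the kernel differences at the
  nodes decay at least like the inverse squares of the cyclic distance to the node 0, so that their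
  sum is bounded independently of the number of nodes.
\<close>

lemma sum_kernel_differences_le:
  fixes l N :: nat and \<delta> q :: real
  defines "M \<equiv> (l + 4) * N" and "c \<equiv> 3 * real (l + 4)"
  assumes N: "0 < N" and \<delta>: "0 < \<delta>" "\<delta> * real N \<le> 1" and q: "0 < q" "2 \<le> real l * q"
  shows "(\<Sum>j<M. norm (interp_kernel (Suc l) N M (2 * pi * real j / real M) -
                        interp_kernel (Suc l) N M (2 * pi * real j / real M - \<delta>)) powr q)
           \<le> real (2 * l + 5) powr q * (1 + 4 * c\<^sup>2) * (\<delta> * real N) powr q"
proof -
  define t where "t j = 2 * pi * real j / real M" for j
  define e where "e j = norm (interp_kernel (Suc l) N M (t j) - interp_kernel (Suc l) N M (t j - \<delta>))" for j
  define A where "A = real (2 * l + 5) * (\<delta> * real N)"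
  have A: "0 \<le> A" using \<delta> by (simp add: A_def)
  have M: "0 < M" "N \<le> M" using N by (auto simp: M_def)
  have e_le: "e j \<le> A * g ^ l"
    if "norm (exp_mean N (t j)) \<le> g" "norm (exp_mean N (t j - \<delta>)) \<le> g" "g \<le> 1" for j g
    using interp_kernel_lipschitz[OF that N M(2), of l] \<delta>
    by (simp add: e_def A_def M_def algebra_simps)
  have e0: "e 0 powr q \<le> A powr q"
    using e_le[of 0 1] norm_exp_mean_le q by (intro powr_mono2) (auto simp: e_def)
  have ej: "e j powr q \<le> A powr q * c\<^sup>2 * (1 / real j ^ 2
      + 1 / real (M - j) ^ 2)" if j: "0 < j" "j < M" for j
  proof -
    define d where "d = real (min j (M - j))"
    define g where "g = min 1 (c / d)"
    have d: "0 < d" using j by (simp add: d_def)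
    have c: "0 < c" by (simp add: c_def)
    have g: "0 < g" "g \<le> 1" "g \<le> c / d" using c d by (auto simp: g_def)
    have "e j \<le> A * g ^ l"
      using exp_mean_node_le[OF N \<delta> j[unfolded M_def], of "t j" "t j"]
        exp_mean_node_le[OF N \<delta> j[unfolded M_def], of "t j" "t j - \<delta>"]
      by (intro e_le) (auto simp: g_def c_def d_def t_def M_def)
    then have "e j powr q \<le> (A * g ^ l) powr q"
      using q by (intro powr_mono2) (auto simp: e_def)
    also have "\<dots> = A powr q * g powr (real l * q)"
      using A g by (simp add: powr_mult powr_realpow[symmetric] powr_powr)
    also have "g powr (real l * q) \<le> g powr 2"
      using g q by (intro powr_mono') auto
    also have "g powr 2 = g ^ 2" using g by simp
    also have "\<dots> \<le> (c / d) ^ 2" using g by (intro power_mono) auto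
    also have "\<dots> = c\<^sup>2 * (1 / d ^ 2)" by (simp add: power_divide)
    also have "1 / d ^ 2 \<le> 1 / real j ^ 2 + 1 / real (M - j) ^ 2"
      by (cases "j \<le> M - j") (auto simp: d_def)
    finally show ?thesis by (simp add: mult_left_mono mult.assoc)
  qed
  have "{..<M} = insert 0 {1..<M}" using M by auto
  then have "(\<Sum>j<M. e j powr q) = e 0 powr q + (\<Sum>j\<in>{1..<M}. e j powr q)"
    by simp
  also have "\<dots> \<le> A powr q + (\<Sum>j\<in>{1..<M}. A powr q * c\<^sup>2 * (1 / real j ^ 2 + 1 / real (M - j) ^ 2))"
    by (intro add_mono e0 sum_mono ej) auto
  also have "\<dots> = A powr q + A powr q * c\<^sup>2 *
      ((\<Sum>j\<in>{1..<M}. 1 / real j ^ 2) + (\<Sum>j\<in>{1..<M}. 1 / real (M - j) ^ 2))"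
    by (simp only: sum_distrib_left[symmetric] sum.distrib)
  also have "(\<Sum>j\<in>{1..<M}. 1 / real (M - j) ^ 2) = (\<Sum>j\<in>{1..<M}. 1 / real j ^ 2)"
    by (rule sum.reindex_bij_witness[of _ "\<lambda>j. M - j" "\<lambda>j. M - j"]) auto
  also have "A powr q + A powr q * c\<^sup>2 * ((\<Sum>j\<in>{1..<M}. 1 / real j ^ 2) + (\<Sum>j\<in>{1..<M}. 1 / real j ^ 2))
      \<le> A powr q + A powr q * c\<^sup>2 * (2 + 2)"
  proof -
    have "{1..<M} = {1..M - 1}" using M by auto
    then have "(\<Sum>j\<in>{1..<M}. 1 / real j ^ 2) \<le> 2"
      using sum_inverse_squares_le[of "M - 1"] by simp
    then show ?thesis by (intro add_left_mono mult_left_mono add_mono) auto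
  qed
  also have "\<dots> = A powr q * (1 + 4 * c\<^sup>2)" by (simp add: algebra_simps)
  also have "A powr q = real (2 * l + 5) powr q * (\<delta> * real N) powr q"
    unfolding A_def by (rule powr_mult)
  also have "\<dots> * (1 + 4 * c\<^sup>2) = real (2 * l + 5) powr q * (1 + 4 * c\<^sup>2) * (\<delta> * real N) powr q"
    by (simp only: mult_ac)
  finally show ?thesis by (simp add: e_def t_def)
qed

section \<open>Bernstein inequality for differences\<close>

lemma qnorm_sum:
  assumes "0 < p" "finite A" "\<And>i. i \<in> A \<Longrightarrow> torus_fun (f i)"
  shows "qnorm p (\<lambda>x. \<Sum>i\<in>A. f i x) \<le> (\<Sum>i\<in>A. qnorm p (f i))"
  using assms(2,3)
proof (induction A rule: finite_induct)
  case empty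
  have "torus_fun (\<lambda>_. 0)" by (simp add: torus_fun_def periodic_2pi_def)
  from qnorm_cmult[OF assms(1) this, of 0] show ?case by simp
next
  case (insert i A)
  have "qnorm p (\<lambda>x. f i x + (\<Sum>i\<in>A. f i x)) \<le> qnorm p (f i) + qnorm p (\<lambda>x. \<Sum>i\<in>A. f i x)"
    using insert by (intro qnorm_add assms(1) torus_fun_sum) auto
  also have "\<dots> \<le> qnorm p (f i) + (\<Sum>i\<in>A. qnorm p (f i))"
    using insert by (intro add_left_mono) auto
  finally show ?case using insert by simp
qed

text \<open>
  Both values in \<open>T x - T (x + \<delta>)\<close> are interpolated from the same nodes \<open>x + t j\<close>. The
  difference becomes a combination of translates of \<open>T\<close>, all of which have the same norm as
  \<open>T\<close>, and the coefficients are differences of the kernel. This works for every \<open>p > 0\<close>.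
\<close>

lemma bernstein_difference:
  assumes p: "0 < p"
  obtains B where "1 \<le> B" "\<And>N \<delta> T. T \<in> trig_polys N \<Longrightarrow> 0 < N \<Longrightarrow> 0 < \<delta> \<Longrightarrow> \<delta> * real N \<le> 1 \<Longrightarrow>
    qnorm p (diff_step \<delta> T) \<le> ennreal (B * (\<delta> * real N) powr enn2real (min p 1)) * qnorm p T"
proof -
  define q where "q = enn2real (min p 1)"
  have q: "0 < q" using min_one_exponent[OF p] by (simp add: q_def)
  \<comment> \<open>The smaller \<open>q\<close> is, the faster the kernel has to decay.\<close>
  obtain l :: nat where "2 / q \<le> real l" using real_arch_simple by blast
  then have l: "2 \<le> real l * q" using q by (simp add: field_simps)
  define B where "B = real (2 * l + 5) powr q * (1 + 4 * (3 * real (l + 4))\<^sup>2)"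
  have "1 * 1 \<le> B" unfolding B_def using q by (intro mult_mono) (auto intro!: ge_one_powr_ge_zero)
  moreover have "qnorm p (diff_step \<delta> T) \<le> ennreal (B * (\<delta> * real N) powr q) * qnorm p T"
    if T: "T \<in> trig_polys N" and N: "0 < N" and \<delta>: "0 < \<delta>" "\<delta> * real N \<le> 1" for N \<delta> T
  proof -
    define M where "M = (l + 4) * N"
    have M: "(Suc l + 2) * N < M" unfolding M_def using N by (intro mult_strict_right_mono) auto
    define t where "t j = 2 * pi * real j / real M" for j
    define e where "e j = interp_kernel (Suc l) N M (t j) - interp_kernel (Suc l) N M (t j - \<delta>)" for j
    have tf: "torus_fun T" using T by (rule torus_fun_trig_poly)
    have "diff_step \<delta> T = (\<lambda>x. \<Sum>j<M. e j * T (x + t j))"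
    proof
      fix x
      have "T y = (\<Sum>j<M. T (x + t j) * interp_kernel (Suc l) N M (x + t j - y))" for y
        unfolding t_def by (rule trig_poly_interpolation[OF T _ M]) (use N in auto)
      from this[of x] this[of "x + \<delta>"] show "diff_step \<delta> T x = (\<Sum>j<M. e j * T (x + t j))"
        by (simp add: diff_step_def e_def sum_subtractf right_diff_distrib mult.commute)
    qed
    then have "qnorm p (diff_step \<delta> T) \<le> (\<Sum>j<M. qnorm p (\<lambda>x. e j * T (x + t j)))"
      by (simp only:) (intro qnorm_sum p finite_lessThan torus_fun_cmult torus_fun_translate tf)
    also have "\<dots> = (\<Sum>j<M. ennreal (norm (e j) powr q) * qnorm p T)"
    proof (intro sum.cong refl)
      fix j assume "j \<in> {..<M}"
      then have "t j < 2 * pi" "0 \<le> t j" by (auto simp: t_def field_simps)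
      then show "qnorm p (\<lambda>x. e j * T (x + t j)) = ennreal (norm (e j) powr q) * qnorm p T"
        by (simp add: qnorm_cmult[OF p torus_fun_translate[OF tf]] qnorm_translate[OF tf] q_def)
    qed
    also have "\<dots> = ennreal (\<Sum>j<M. norm (e j) powr q) * qnorm p T"
      by (simp add: sum_distrib_right[symmetric])
    also have "\<dots> \<le> ennreal (B * (\<delta> * real N) powr q) * qnorm p T"
      using sum_kernel_differences_le[OF N \<delta> q l]
      by (intro mult_right_mono ennreal_leI) (auto simp: B_def e_def t_def M_def)
    finally show ?thesis .
  qed
  ultimately show ?thesis using that[of B] by (simp add: q_def)
qed

lemma bernstein_fdiff:
  assumes p: "0 < p"
  obtains B where "1 \<le> B" "\<And>N \<delta> T. T \<in> trig_polys N \<Longrightarrow> 0 < N \<Longrightarrow> 0 < \<delta> \<Longrightarrow> \<delta> * real N \<le> 1 \<Longrightarrow>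
    qnorm p (fdiff k \<delta> T) \<le> ennreal (B * (\<delta> * real N) powr (real k * enn2real (min p 1))) * qnorm p T"
proof -
  define q where "q = enn2real (min p 1)"
  obtain B where B: "1 \<le> B" and step: "\<And>N \<delta> T. T \<in> trig_polys N \<Longrightarrow> 0 < N \<Longrightarrow> 0 < \<delta> \<Longrightarrow> \<delta> * real N \<le> 1 \<Longrightarrow>
    qnorm p (diff_step \<delta> T) \<le> ennreal (B * (\<delta> * real N) powr q) * qnorm p T"
    using bernstein_difference[OF p] unfolding q_def by metis
  have "qnorm p (fdiff k \<delta> T) \<le> ennreal (B ^ k * (\<delta> * real N) powr (real k * q)) * qnorm p T"
    if "T \<in> trig_polys N" "0 < N" "0 < \<delta>" "\<delta> * real N \<le> 1" for N \<delta> T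
  proof (induction k)
    case 0
    then show ?case using that by (simp add: fdiff_0)
  next
    case (Suc k)
    have "qnorm p (fdiff (Suc k) \<delta> T) \<le> ennreal (B * (\<delta> * real N) powr q) * qnorm p (fdiff k \<delta> T)"
      unfolding fdiff_Suc using that by (intro step trig_polys_fdiff)
    also have "\<dots> \<le> ennreal (B * (\<delta> * real N) powr q) *
        (ennreal (B ^ k * (\<delta> * real N) powr (real k * q)) * qnorm p T)"
      by (intro mult_left_mono Suc) auto
    also have "\<dots> = ennreal ((B * (\<delta> * real N) powr q) * (B ^ k * (\<delta> * real N) powr (real k * q))) * qnorm p T"
      using B by (simp add: ennreal_mult mult.assoc)
    also have "(B * (\<delta> * real N) powr q) * (B ^ k * (\<delta> * real N) powr (real k * q)) =
        B ^ Suc k * (\<delta> * real N) powr (real (Suc k) * q)"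
      by (simp add: distrib_right powr_add)
    finally show ?case .
  qed
  moreover have "1 \<le> B ^ k" using B by simp
  ultimately show ?thesis using that[of "B ^ k"] by (simp add: q_def)
qed

lemma qnorm_diff:
  assumes "0 < p" "torus_fun f" "torus_fun g"
  shows "qnorm p (\<lambda>x. f x - g x) \<le> qnorm p f + qnorm p g"
  using qnorm_add[OF assms(1,2) torus_fun_cmult[OF assms(3), of "-1"]]
    qnorm_cmult[OF assms(1,3), of "-1"] by simp

lemma qnorm_fdiff_le:
  assumes p: "0 < p" and f: "torus_fun f" and \<delta>: "0 < \<delta>" "\<delta> \<le> 1"
  shows "qnorm p (fdiff k \<delta> f) \<le> ennreal (2 ^ k) * qnorm p f"
proof (induction k)
  case (Suc k)
  define g where "g = fdiff k \<delta> f"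
  have g: "torus_fun g" using f by (simp add: g_def torus_fun_fdiff)
  have "qnorm p (fdiff (Suc k) \<delta> f) \<le> qnorm p g + qnorm p (\<lambda>x. g (x + \<delta>))"
    unfolding fdiff_Suc diff_step_def g_def[symmetric] using g
        by (intro qnorm_diff p torus_fun_translate)
  also have "qnorm p (\<lambda>x. g (x + \<delta>)) = qnorm p g"
    using \<delta> pi_gt3 by (intro qnorm_translate g) auto
  also have "qnorm p g + qnorm p g = 2 * qnorm p g" by (simp add: mult_2)
  also have "\<dots> \<le> 2 * (ennreal (2 ^ k) * qnorm p f)"
    using Suc by (intro mult_left_mono) (auto simp: g_def)
  also have "\<dots> = ennreal (2 ^ Suc k) * qnorm p f"
    by (simp add: ennreal_mult mult.assoc)
  finally show ?case .
qed (simp add: fdiff_0)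

section \<open>Best approximation\<close>

lemma ennreal_powr_le_cancel:
  assumes "ennreal_powr x a \<le> ennreal_powr y a" "0 < a" shows "x \<le> y"
proof -
  have "ennreal_powr (ennreal_powr x a) (1 / a) \<le> ennreal_powr (ennreal_powr y a) (1 / a)"
    by (rule ennreal_powr_mono) (use assms in auto)
  moreover have "ennreal_powr (ennreal_powr z a) (1 / a) = z" for z
    using ennreal_powr_powr[of a "1 / a" z] assms(2) by simp
  ultimately show ?thesis by simp
qed

lemma best_approx_antimono: "antimono (\<lambda>\<nu>. best_approx p r \<alpha> \<nu> f)"
  unfolding best_approx_def by (intro antimonoI INF_superset_mono trig_polys_mono) auto

text \<open>
  The slack is additive because a multiplicative one would not suffice when the best
  approximation is 0 and not attained.
\<close>

lemma near_best_approx: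
  assumes q: "0 < q" and \<eta>: "0 < \<eta>"
  obtains T where "T \<in> trig_polys \<nu>"
    "ennreal_powr (holder_norm p r \<alpha> (\<lambda>x. f x - T x)) q \<le> ennreal_powr (best_approx p r \<alpha> \<nu> f) q
        + ennreal \<eta>"
proof (cases "best_approx p r \<alpha> \<nu> f")
  case (real e)
  define e' where "e' = (e powr q + \<eta>) powr (1 / q)"
  have e': "e' powr q = e powr q + \<eta>"
    using q \<eta> by (simp add: e'_def powr_powr)
  have "e < e'"
  proof (rule ccontr)
    assume "\<not> e < e'"
    then have "e' powr q \<le> e powr q" using q by (intro powr_mono2) (auto simp: e'_def)
    with e' \<eta> show False by simp
  qed
  then have "best_approx p r \<alpha> \<nu> f < ennreal e'" using real by (simp add: ennreal_lessI)
  then obtain T where T: "T \<in> trig_polys \<nu>" "holder_norm p r \<alpha> (\<lambda>x. f x - T x) < ennreal e'"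
    unfolding best_approx_def INF_less_iff by blast
  have "ennreal_powr (holder_norm p r \<alpha> (\<lambda>x. f x - T x)) q \<le> ennreal_powr (ennreal e') q"
    using T(2) q by (intro ennreal_powr_mono) auto
  also have "\<dots> = ennreal_powr (best_approx p r \<alpha> \<nu> f) q + ennreal \<eta>"
    using real \<eta> e' by (simp add: ennreal_powr_ennreal e'_def)
  finally show ?thesis using T(1) that by blast
next
  case top
  have "(\<lambda>_. 0) \<in> trig_polys \<nu>" using trig_polysI[where N = \<nu> and c = "\<lambda>_. 0"] by simp
  then show ?thesis using top that by (simp add: ennreal_powr_def)
qed

lemma fdiff_minus: "fdiff k \<delta> (\<lambda>x. f x - g x) = (\<lambda>x. fdiff k \<delta> f x - fdiff k \<delta> g x)"
  by (auto simp: fdiff_def algebra_simps sum_subtractf)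

lemma fdiff_const_eq_0:
  assumes "T \<in> trig_polys 0" "1 \<le> r" shows "fdiff r h T = (\<lambda>_. 0)"
proof -
  obtain c where "T = (\<lambda>_. c)" using trig_polysE[OF assms(1)] by auto
  moreover obtain r' where "r = Suc r'" using assms(2) by (cases r) auto
  moreover have "fdiff (Suc r') h (\<lambda>_. c) = (\<lambda>_. 0)"
    by (induction r') (auto simp: fdiff_Suc fdiff_0 diff_step_def)
  ultimately show ?thesis by simp
qed

text \<open>
  The term with index \<open>j > 0\<close> is absorbed by the block \<open>2 ^ (j - 1) < \<nu> \<le> 2 ^ j\<close> of the sum on
  the right, on which \<open>a \<nu> \<ge> a (2 ^ j)\<close>, and the term with index 0 by the summand \<open>a 0\<close>.
\<close>

lemma dyadic_sum_le:
  fixes a :: "nat \<Rightarrow> ennreal" and \<beta> :: real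
  assumes a: "antimono a" and \<beta>: "0 < \<beta>"
  shows "(\<Sum>j\<le>m. ennreal (real (2 ^ j) powr \<beta>) * a (2 ^ j)) \<le>
    ennreal (4 * 2 powr \<beta>) * (\<Sum>\<nu>=0..2 ^ m. ennreal (real (\<nu> + 1) powr (\<beta> - 1)) * a \<nu>)"
    (is "?L m \<le> ?K * ?R (2 ^ m)")
proof (induction m)
  case 0
  have "?L 0 = a 1" by simp
  also have "\<dots> \<le> a 0" using a by (simp add: antimonoD)
  also have "\<dots> \<le> ?R (2 ^ 0)" by simp
  also have "\<dots> = 1 * \<dots>" by simp
  also have "\<dots> \<le> ?K * ?R (2 ^ 0)"
  proof (rule mult_right_mono)
    have "1 * 1 \<le> 4 * 2 powr \<beta>" using \<beta> by (intro mult_mono ge_one_powr_ge_zero) auto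
    then show "1 \<le> ?K" by (simp add: ennreal_leI flip: ennreal_1)
  qed simp
  finally show ?case .
next
  case (Suc m)
  define b where "b = a (2 ^ Suc m)"
  define I :: "nat set" where "I = {2 ^ m + 1..2 ^ Suc m}"
  define x where "x = real (2 ^ m) powr \<beta> / real (2 ^ (m + 2))"
  have assoc: "ennreal (u * v) * b = ennreal u * (ennreal v * b)" if "0 \<le> u" for u v
    by (simp only: ennreal_mult'[OF that] mult.assoc)
  have "card I = 2 ^ m" by (simp add: I_def)
  then have card: "of_nat (card I) = ennreal (real (2 ^ m))"
    by (simp only: ennreal_of_nat_eq_real_of_nat)
  have "real (2 ^ Suc m) powr \<beta> = 4 * 2 powr \<beta> * (real (2 ^ m) * x)"
    by (simp add: x_def powr_mult)
  then have "ennreal (real (2 ^ Suc m) powr \<beta>) * b = ?K * (ennreal (real (2 ^ m) * x) * b)"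
    by (simp only:) (rule assoc, simp)
  also have "ennreal (real (2 ^ m) * x) * b = (\<Sum>\<nu>\<in>I. ennreal x * b)"
    by (simp only: sum_constant card) (rule assoc, simp)
  also have "?K * \<dots> \<le> ?K * (\<Sum>\<nu>\<in>I. ennreal (real (\<nu> + 1) powr (\<beta> - 1)) * a \<nu>)"
    unfolding x_def I_def
  proof (intro mult_left_mono sum_mono mult_mono ennreal_leI)
    fix \<nu> :: nat assume \<nu>: "\<nu> \<in> {2 ^ m + 1..2 ^ Suc m}"
    then have "\<nu> \<le> 2 ^ Suc m" by (simp only: atLeastAtMost_iff)
    then show "b \<le> a \<nu>" unfolding b_def by (rule antimonoD[OF a])
    have "\<nu> + 1 \<le> 2 ^ (m + 2)" 
    proof -
      have "(2 :: nat) ^ (m + 2) = 2 * 2 ^ Suc m" "1 \<le> (2 :: nat) ^ Suc m" by simp_all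
      with \<open>\<nu> \<le> _\<close> show ?thesis by linarith
    qed
    then have le: "real (\<nu> + 1) \<le> real (2 ^ (m + 2))" by (simp only: of_nat_le_iff)
    have ge: "real (2 ^ m) \<le> real (\<nu> + 1)" using \<nu> by (simp only: of_nat_le_iff) auto
    have "real (2 ^ m) powr \<beta> / real (2 ^ (m + 2)) \<le> real (\<nu> + 1) powr \<beta> / real (\<nu> + 1)"
      using \<beta> le ge by (intro frac_le powr_mono2) auto
    also have "\<dots> = real (\<nu> + 1) powr (\<beta> - 1)" by (simp add: powr_diff)
    finally show "real (2 ^ m) powr \<beta> / real (2 ^ (m + 2)) \<le> real (\<nu> + 1) powr (\<beta> - 1)" .
  qed auto
  finally have new: "ennreal (real (2 ^ Suc m) powr \<beta>) * b \<le> \<dots>" .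
  have "{0..2 ^ Suc m} = {0..2 ^ m} \<union> I" by (auto simp: I_def)
  then have R: "?R (2 ^ Suc m) = ?R (2 ^ m) + (\<Sum>\<nu>\<in>I. ennreal (real (\<nu> + 1) powr (\<beta> - 1)) * a \<nu>)"
    by (simp only:) (rule sum.union_disjoint, auto simp: I_def)
  have "?L (Suc m) = ?L m + ennreal (real (2 ^ Suc m) powr \<beta>) * b" by (simp add: b_def)
  also have "\<dots> \<le> ?K * ?R (2 ^ m) + ?K * (\<Sum>\<nu>\<in>I. ennreal (real (\<nu> + 1) powr (\<beta> - 1)) * a \<nu>)"
    by (intro add_mono Suc new)
  also have "\<dots> = ?K * ?R (2 ^ Suc m)" unfolding R by (simp only: distrib_left)
  finally show ?case .
qed

section \<open>The inverse estimate\<close>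

text \<open>
  The estimate for fixed steps \<open>h\<close> and \<open>\<delta>\<close>, with \<open>Y \<nu>\<close> bounding the \<open>q\<close>-th power of the Hoelder
  norm of \<open>f - T \<nu>\<close>. The function \<open>f\<close> is decomposed into \<open>f - T (2 ^ m)\<close>, the dyadic differences
  \<open>T (2 ^ (j + 1)) - T (2 ^ j)\<close>, the difference \<open>T 1 - T 0\<close> and the constant \<open>T 0\<close>.
\<close>

lemma mixed_difference_le:
  fixes p :: ennreal and f :: "real \<Rightarrow> complex" and T :: "nat \<Rightarrow> real \<Rightarrow> complex" and h \<delta> :: real
  defines "q \<equiv> enn2real (min p 1)"
  assumes p: "0 < p" and r: "1 \<le> r" and B: "0 \<le> B"
    and bernstein: "\<And>N \<delta> T. T \<in> trig_polys N \<Longrightarrow> 0 < N \<Longrightarrow> 0 < \<delta> \<Longrightarrow> \<delta> * real N \<le> 1 \<Longrightarrow>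
      qnorm p (fdiff k \<delta> T) \<le> ennreal (B * (\<delta> * real N) powr (real k * q)) * qnorm p T"
    and f: "torus_fun f" and T: "\<And>\<nu>. T \<nu> \<in> trig_polys \<nu>"
    and Y: "\<And>\<nu>. ennreal_powr (holder_norm p r \<alpha> (\<lambda>x. f x - T \<nu> x)) q \<le> Y \<nu>"
    and n: "2 ^ m \<le> n" "n < 2 ^ Suc m" and h: "0 < h" and \<delta>: "0 < \<delta>" "\<delta> \<le> 1 / real n"
  shows "ennreal_powr (ennreal (h powr - \<alpha>) * Lp_norm p (fdiff k \<delta> (fdiff r h f))) q \<le>
    ennreal ((2 ^ k * 2 powr (real k * q) + B * (1
        + 2 powr (real k * q))) / real n powr (real k * q)) *
      (Y 0 + (\<Sum>j\<le>m. ennreal (real (2 ^ j) powr (real k * q)) * Y (2 ^ j)))"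
proof -
  define \<beta> where "\<beta> = real k * q"
  define c where "c = (h powr - \<alpha>) powr q"
  \<comment> \<open>The claim is about \<open>\<Psi> f\<close>; the errors \<open>Y \<nu>\<close> control \<open>D (f - T \<nu>)\<close>.\<close>
  define D where "D g = ennreal c * qnorm p (fdiff r h g)" for g
  define \<Psi> where "\<Psi> g = ennreal c * qnorm p (fdiff k \<delta> (fdiff r h g))" for g
  define w where "w j = real (2 ^ j) powr \<beta>" for j
  have q: "0 < q" using min_one_exponent[OF p] by (simp add: q_def)
  have \<beta>: "0 \<le> \<beta>" using q by (simp add: \<beta>_def)
  have n0: "0 < n" using n(1) by (cases n) auto
  have \<delta>1: "\<delta> \<le> 1" using order.trans[OF \<delta>(2), of 1] n0 by simp
  have Tf: "torus_fun (T \<nu>)" for \<nu> using T by (rule torus_fun_trig_poly)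
  have D_le: "D (\<lambda>x. f x - T \<nu> x) \<le> Y \<nu>" for \<nu>
  proof -
    have "ennreal (h powr - \<alpha>) * Lp_norm p (fdiff r h (\<lambda>x. f x - T \<nu> x))
        \<le> holder_seminorm p r \<alpha> (\<lambda>x. f x - T \<nu> x)"
      unfolding holder_seminorm_def using h by (intro SUP_upper) auto
    also have "\<dots> \<le> holder_norm p r \<alpha> (\<lambda>x. f x - T \<nu> x)" by (simp add: holder_norm_def)
    finally have "ennreal_powr (ennreal (h powr - \<alpha>) * Lp_norm p (fdiff r h (\<lambda>x. f x - T \<nu> x))) q
        \<le> Y \<nu>"
      using q Y[of \<nu>] ennreal_powr_mono order.trans by blast
    then show ?thesis
      using q by (simp add: D_def c_def qnorm_def q_def[symmetric] ennreal_powr_mult ennreal_powr_ennreal)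
  qed
  have D_diff: "D (\<lambda>x. T \<mu> x - T \<nu> x) \<le> Y \<mu> + Y \<nu>" for \<mu> \<nu>
  proof -
    have "(\<lambda>x. T \<mu> x - T \<nu> x) = (\<lambda>x. (f x - T \<nu> x) - (f x - T \<mu> x))" by auto
    then have "D (\<lambda>x. T \<mu> x - T \<nu> x) \<le> D (\<lambda>x. f x - T \<nu> x) + D (\<lambda>x. f x - T \<mu> x)"
      unfolding D_def distrib_left[symmetric]
      by (simp only: fdiff_minus[where f = "\<lambda>x. f x - T \<nu> x"])
         (intro mult_left_mono qnorm_diff p torus_fun_fdiff torus_fun_diff f Tf, simp)
    also have "\<dots> \<le> Y \<nu> + Y \<mu>" by (intro add_mono D_le)
    finally show ?thesis by (simp add: add.commute)
  qed
  have \<Psi>_split: "\<Psi> g \<le> \<Psi> (\<lambda>x. g x - g' x) + \<Psi> g'" if "torus_fun g" "torus_fun g'" for g g'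
  proof -
    have "fdiff k \<delta> (fdiff r h g) =
        (\<lambda>x. fdiff k \<delta> (fdiff r h (\<lambda>x. g x - g' x)) x + fdiff k \<delta> (fdiff r h g') x)"
      by (simp add: fdiff_minus)
    then show ?thesis
      unfolding \<Psi>_def distrib_left[symmetric]
      by (simp only:) (intro mult_left_mono qnorm_add p torus_fun_fdiff torus_fun_diff that, simp)
  qed
  have \<Psi>_le: "\<Psi> (\<lambda>x. f x - T \<nu> x) \<le> ennreal (2 ^ k) * Y \<nu>" for \<nu>
  proof -
    have "\<Psi> (\<lambda>x. f x - T \<nu> x) \<le> ennreal c * (ennreal (2 ^ k) * qnorm p (fdiff r h (\<lambda>x. f x - T \<nu> x)))"
      unfolding \<Psi>_def using \<delta> \<delta>1
      by (intro mult_left_mono qnorm_fdiff_le p torus_fun_fdiff torus_fun_diff f Tf) auto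
    also have "\<dots> = ennreal (2 ^ k) * D (\<lambda>x. f x - T \<nu> x)"
      by (simp only: D_def mult_ac)
    also have "\<dots> \<le> ennreal (2 ^ k) * Y \<nu>" by (intro mult_left_mono D_le) auto
    finally show ?thesis .
  qed
  have \<Psi>_block: "\<Psi> (\<lambda>x. T (2 ^ j) x - T \<nu> x) \<le> ennreal (B * w j / real n powr \<beta>) * (Y (2 ^ j) + Y \<nu>)"
    if j: "j \<le> m" and \<nu>: "\<nu> \<le> 2 ^ j" for j \<nu>
  proof -
    have "(2 :: nat) ^ j \<le> n" using j n(1) power_increasing[of j m "2 :: nat"] by linarith
    then have jn: "real (2 ^ j) \<le> real n" by (simp only: of_nat_le_iff)
    have "\<delta> * real (2 ^ j) \<le> 1 / real n * real (2 ^ j)" using \<delta> by (intro mult_right_mono) auto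
    then have \<delta>j: "\<delta> * real (2 ^ j) \<le> real (2 ^ j) / real n" by simp
    also have "\<dots> \<le> 1" using jn n0 by simp
    finally have \<delta>1: "\<delta> * real (2 ^ j) \<le> 1" .
    define Q where "Q = (\<lambda>x. T (2 ^ j) x - T \<nu> x)"
    have "T \<nu> \<in> trig_polys (2 ^ j)" using T trig_polys_mono[OF \<nu>] by blast
    \<comment> \<open>The Bernstein inequality is applied to \<open>fdiff r h Q\<close>, so only \<open>D Q\<close> enters.\<close>
    then have "fdiff r h Q \<in> trig_polys (2 ^ j)"
      unfolding Q_def by (intro trig_polys_fdiff trig_polys_diff T)
    then have "\<Psi> Q \<le> ennreal c * (ennreal (B * (\<delta> * real (2 ^ j)) powr \<beta>) * qnorm p (fdiff r h Q))"
      unfolding \<Psi>_def \<beta>_def using \<delta> \<delta>1 by (intro mult_left_mono bernstein) auto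
    also have "\<dots> = ennreal (B * (\<delta> * real (2 ^ j)) powr \<beta>) * D Q"
      by (simp only: D_def mult_ac)
    also have "\<dots> \<le> ennreal (B * w j / real n powr \<beta>) * (Y (2 ^ j) + Y \<nu>)"
    proof (intro mult_mono ennreal_leI)
      have "(\<delta> * real (2 ^ j)) powr \<beta> \<le> (real (2 ^ j) / real n) powr \<beta>"
        using \<delta> \<delta>j \<beta> by (intro powr_mono2) auto
      also have "\<dots> = w j / real n powr \<beta>" unfolding w_def by (rule powr_divide) 
      finally show "B * (\<delta> * real (2 ^ j)) powr \<beta> \<le> B * w j / real n powr \<beta>"
        using B mult_left_mono by fastforce
    qed (auto simp: Q_def D_diff)
    finally show ?thesis by (simp add: Q_def)
  qed
  have \<Psi>0: "\<Psi> (T 0) = 0"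
  proof -
    have "fdiff k \<delta> (\<lambda>_. 0) = (\<lambda>_. 0)" by (simp add: fdiff_def)
    moreover have "qnorm p (\<lambda>_. 0) = 0" using qnorm_cmult[OF p Tf, of 0] by simp
    ultimately show ?thesis by (simp add: \<Psi>_def fdiff_const_eq_0[OF T r])
  qed
  define V where "V = ennreal (B / real n powr \<beta>)"
  have V: "ennreal (B * w j / real n powr \<beta>) = V * ennreal (w j)" for j
    unfolding V_def using B by (simp add: w_def ennreal_mult[symmetric])
  have w_Suc: "ennreal (w (Suc j)) = ennreal (2 powr \<beta>) * ennreal (w j)" for j
    by (simp add: w_def powr_mult ennreal_mult)
  have tele: "\<Psi> (T (2 ^ i)) \<le> V * (Y 0 + (\<Sum>j\<le>i. ennreal (w j) * Y (2 ^ j)) +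
      ennreal (2 powr \<beta>) * (\<Sum>j<i. ennreal (w j) * Y (2 ^ j)))" if "i \<le> m" for i
    using that
  proof (induction i)
    case 0
    have "\<Psi> (T 1) \<le> \<Psi> (\<lambda>x. T 1 x - T 0 x) + \<Psi> (T 0)" by (intro \<Psi>_split Tf)
    with \<Psi>_block[of 0 0] show ?case
      by (simp add: \<Psi>0 V_def w_def add.commute)
  next
    case (Suc i)
    have "\<Psi> (T (2 ^ Suc i)) \<le> \<Psi> (\<lambda>x. T (2 ^ Suc i) x - T (2 ^ i) x) + \<Psi> (T (2 ^ i))"
      by (intro \<Psi>_split Tf)
    also have "\<dots> \<le> V * ennreal (w (Suc i)) * (Y (2 ^ Suc i) + Y (2 ^ i)) +
        V * (Y 0 + (\<Sum>j\<le>i. ennreal (w j) * Y (2 ^ j))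
            + ennreal (2 powr \<beta>) * (\<Sum>j<i. ennreal (w j) * Y (2 ^ j)))"
      unfolding V[symmetric] using Suc by (intro add_mono \<Psi>_block) auto
    also have "\<dots> = V * (Y 0 + (\<Sum>j\<le>Suc i. ennreal (w j) * Y (2 ^ j)) +
      ennreal (2 powr \<beta>) * (\<Sum>j<Suc i. ennreal (w j) * Y (2 ^ j)))"
      by (simp add: w_Suc distrib_left ac_simps)
    finally show ?case .
  qed
  define S where "S = Y 0 + (\<Sum>j\<le>m. ennreal (w j) * Y (2 ^ j))"
  define U where "U = 2 powr \<beta> / real n powr \<beta>"
  have "\<Psi> f \<le> \<Psi> (\<lambda>x. f x - T (2 ^ m) x) + \<Psi> (T (2 ^ m))" by (intro \<Psi>_split f Tf)
  also have "\<dots> \<le> ennreal (2 ^ k * U) * S + ennreal (B / real n powr \<beta> * (1 + 2 powr \<beta>)) * S"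
  proof (rule add_mono)
    \<comment> \<open>The error term is absorbed by the last dyadic term, because \<open>n < 2 * 2 ^ m\<close>.\<close>
    have "1 \<le> U * w m"
    proof -
      have "n \<le> 2 * 2 ^ m" using n(2) by simp
      then have "real n \<le> real (2 * 2 ^ m)" by (simp only: of_nat_le_iff)
      then have "real n \<le> 2 * real (2 ^ m)" by simp
      then have "real n powr \<beta> \<le> (2 * real (2 ^ m)) powr \<beta>" using \<beta> by (intro powr_mono2) auto
      also have "\<dots> = 2 powr \<beta> * w m" unfolding w_def by (rule powr_mult)
      finally show ?thesis using n0 by (simp add: U_def field_simps)
    qed
    then have "(2 :: real) ^ k * 1 \<le> 2 ^ k * (U * w m)" by (intro mult_left_mono) auto
    then have "ennreal (2 ^ k) * Y (2 ^ m) \<le> ennreal (2 ^ k * (U * w m)) * Y (2 ^ m)"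
      by (intro mult_right_mono ennreal_leI) auto
    also have "\<dots> = ennreal (2 ^ k * U) * (ennreal (w m) * Y (2 ^ m))"
      by (simp add: ennreal_mult[symmetric] mult.assoc[symmetric] U_def w_def)
    also have "\<dots> \<le> ennreal (2 ^ k * U) * S"
    proof (rule mult_left_mono)
      have "ennreal (w m) * Y (2 ^ m) \<le> (\<Sum>j\<le>m. ennreal (w j) * Y (2 ^ j))"
        by (rule member_le_sum) auto
      then show "ennreal (w m) * Y (2 ^ m) \<le> S" by (simp add: S_def add_increasing)
    qed simp
    finally show "\<Psi> (\<lambda>x. f x - T (2 ^ m) x) \<le> ennreal (2 ^ k * U) * S"
      using \<Psi>_le[of "2 ^ m"] by (rule order.trans[rotated])
  next
    have "\<Psi> (T (2 ^ m)) \<le> V * (S + ennreal (2 powr \<beta>) * S)"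
    proof (rule order.trans[OF tele[OF order.refl]], intro mult_left_mono add_mono)
      have "(\<Sum>j<m. ennreal (w j) * Y (2 ^ j)) \<le> (\<Sum>j\<le>m. ennreal (w j) * Y (2 ^ j))"
        by (rule sum_mono2) auto
      then show "(\<Sum>j<m. ennreal (w j) * Y (2 ^ j)) \<le> S" by (simp add: S_def add_increasing)
    qed (auto simp: S_def)
    also have "\<dots> = V * (ennreal (1 + 2 powr \<beta>) * S)"
      by (simp add: distrib_right)
    also have "\<dots> = ennreal (B / real n powr \<beta> * (1 + 2 powr \<beta>)) * S"
      unfolding V_def using B by (subst ennreal_mult) (auto simp: mult.assoc)
    finally show "\<Psi> (T (2 ^ m)) \<le> ennreal (B / real n powr \<beta> * (1 + 2 powr \<beta>)) * S" .
  qed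
  also have "\<dots> = ennreal (2 ^ k * U + B / real n powr \<beta> * (1 + 2 powr \<beta>)) * S"
    using B by (subst ennreal_plus) (auto simp: U_def distrib_right)
  also have "2 ^ k * U + B / real n powr \<beta> * (1 + 2 powr \<beta>) =
      (2 ^ k * 2 powr \<beta> + B * (1 + 2 powr \<beta>)) / real n powr \<beta>"
    by (simp add: U_def add_divide_distrib)
  finally have "\<Psi> f \<le> ennreal ((2 ^ k * 2 powr \<beta> + B * (1 + 2 powr \<beta>)) / real n powr \<beta>) * S" .
  moreover have "ennreal_powr (ennreal (h powr - \<alpha>) * Lp_norm p (fdiff k \<delta> (fdiff r h f))) q = \<Psi> f"
    using q by (simp add: \<Psi>_def c_def qnorm_def q_def[symmetric] ennreal_powr_mult ennreal_powr_ennreal)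
  ultimately show ?thesis by (simp add: S_def w_def \<beta>_def)
qed

lemma holder_space_torus_fun: assumes "f \<in> holder_space p r \<alpha>" shows "torus_fun f"
proof (cases "p = \<infinity>")
  case True
  then have "periodic_2pi f" "continuous_on UNIV f"
    using assms by (auto simp: holder_space_def Lp_space_def)
  then show ?thesis
    unfolding torus_fun_def by (auto intro!: measurable_completion borel_measurable_continuous_onI)
next
  case False
  then show ?thesis using assms by (auto simp: holder_space_def Lp_space_def torus_fun_def)
qed

theorem theorem3p5:
  fixes p :: ennreal and r k :: nat and \<alpha> p1 :: real
  assumes "0 < p" and "1 \<le> r" and "1 \<le> k" and "0 < \<alpha>" and "\<alpha> \<le> real r"
    and "p1 = enn2real (min p 1)"
  shows "\<exists>C > 0 :: real. \<forall>f \<in> holder_space p r \<alpha>. \<forall>n :: nat. 1 \<le> n \<longrightarrow>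
    psi_modulus k r \<alpha> p f (1 / real n) \<le>
      ennreal (C / real n ^ k) *
      ennreal_powr
        (\<Sum>\<nu>=0..n. ennreal (real (\<nu> + 1) powr (real k * p1 - 1)) *
                   ennreal_powr (best_approx p r \<alpha> \<nu> f) p1)
        (1 / p1)"
proof -
  have p1: "0 < p1" using min_one_exponent[OF assms(1)] assms(6) by simp
  define \<beta> where "\<beta> = real k * p1"
  have \<beta>: "0 < \<beta>" using p1 assms(3) by (simp add: \<beta>_def)
  obtain B where B: "1 \<le> B" and bernstein: "\<And>N \<delta> T. T \<in> trig_polys N \<Longrightarrow> 0 < N \<Longrightarrow> 0 < \<delta> \<Longrightarrow> \<delta> * real N
      \<le> 1 \<Longrightarrow>
    qnorm p (fdiff k \<delta> T) \<le> ennreal (B * (\<delta> * real N) powr (real k * p1)) * qnorm p T"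
    using bernstein_fdiff[OF assms(1), of k] unfolding assms(6) by metis
  define K where "K = 2 ^ k * 2 powr \<beta> + B * (1 + 2 powr \<beta>)"
  define L where "L = K * (1 + 4 * 2 powr \<beta>)"
  have K: "0 < K" using B by (auto simp: K_def intro!: add_pos_pos mult_pos_pos)
  then have L: "0 < L" by (auto simp: L_def intro!: mult_pos_pos add_pos_pos)
  define C where "C = L powr (1 / p1)"
  have C: "0 < C" using L by (simp add: C_def)
  show ?thesis
  proof (intro exI[of _ C] conjI ballI allI impI C)
    fix f and n :: nat
    assume f: "f \<in> holder_space p r \<alpha>" and n: "1 \<le> n"
    define E where "E \<nu> = ennreal_powr (best_approx p r \<alpha> \<nu> f) p1" for \<nu>
    define S where "S = (\<Sum>\<nu>=0..n. ennreal (real (\<nu> + 1) powr (\<beta> - 1)) * E \<nu>)"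
    have E: "antimono E"
      unfolding E_def using best_approx_antimono p1
      by (intro antimonoI ennreal_powr_mono) (auto simp: antimono_def)
    obtain m where m: "2 ^ m \<le> n" "n < 2 ^ Suc m" using ex_power_ivl1[of 2 n] n by auto
    have "ennreal (h powr - \<alpha>) * Lp_norm p (fdiff k \<delta> (fdiff r h f))
        \<le> ennreal (C / real n ^ k) * ennreal_powr S (1 / p1)"
      if h: "0 < h" and \<delta>: "0 < \<delta>" "\<delta> < 1 / real n" for h \<delta>
    proof (rule ennreal_powr_le_cancel[OF _ p1])
      define G where "G = (\<Sum>j\<le>m. ennreal (real (2 ^ j) powr \<beta>) * E (2 ^ j))"
      define H where "H = 1 + (\<Sum>j\<le>m. real (2 ^ j) powr \<beta>)"
      have H: "0 < H" unfolding H_def by (intro add_pos_nonneg sum_nonneg) auto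
      have "ennreal_powr (ennreal (h powr - \<alpha>) * Lp_norm p (fdiff k \<delta> (fdiff r h f))) p1
          \<le> ennreal (K / real n powr \<beta>) * (E 0 + G)"
      proof (rule ennreal_le_epsilon)
        fix e :: real assume e: "0 < e"
        \<comment> \<open>This choice makes the total contribution of the slacks equal to \<open>e\<close>.\<close>
        define \<eta> where "\<eta> = e * real n powr \<beta> / (K * H)"
        have \<eta>: "0 < \<eta>" using e n K H by (simp add: \<eta>_def)
        have "\<forall>\<nu>. \<exists>T. T \<in> trig_polys \<nu> \<and>
            ennreal_powr (holder_norm p r \<alpha> (\<lambda>x. f x - T x)) p1 \<le> E \<nu> + ennreal \<eta>"
          unfolding E_def using near_best_approx[OF p1 \<eta>] by metis
        then obtain T where T: "\<And>\<nu>. T \<nu> \<in> trig_polys \<nu>"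
          "\<And>\<nu>. ennreal_powr (holder_norm p r \<alpha> (\<lambda>x. f x - T \<nu> x)) p1 \<le> E \<nu> + ennreal \<eta>"
          by metis
        have "ennreal_powr (ennreal (h powr - \<alpha>) * Lp_norm p (fdiff k \<delta> (fdiff r h f))) p1 \<le>
            ennreal (K / real n powr \<beta>) * ((E 0 + ennreal \<eta>) +
              (\<Sum>j\<le>m. ennreal (real (2 ^ j) powr \<beta>) * (E (2 ^ j) + ennreal \<eta>)))"
          unfolding K_def \<beta>_def assms(6)
          using B assms(1,2) bernstein T m h \<delta> holder_space_torus_fun[OF f]
          by (intro mixed_difference_le) (auto simp: assms(6))
        also have "\<dots> = ennreal (K / real n powr \<beta>) * (E 0 + G)
            + ennreal (K / real n powr \<beta>) * (ennreal H * ennreal \<eta>)"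
        proof -
          define W where "W = (\<Sum>j\<le>m. ennreal (real (2 ^ j) powr \<beta>))"
          have "ennreal H = 1 + W"
            unfolding H_def W_def by (subst ennreal_plus) (auto intro: sum_nonneg simp: sum_ennreal)
          moreover have "(\<Sum>j\<le>m. ennreal (real (2 ^ j) powr \<beta>) * (E (2 ^ j) + ennreal \<eta>)) = G
              + W * ennreal \<eta>"
            unfolding G_def W_def sum_distrib_right by (simp only: distrib_left sum.distrib)
          ultimately show ?thesis
            by (simp only: distrib_left distrib_right mult_1 ac_simps)
        qed
        also have "ennreal (K / real n powr \<beta>) * (ennreal H * ennreal \<eta>) = ennreal e"
        proof -
          have "K / real n powr \<beta> * (H * \<eta>) = e" using K H n by (simp add: \<eta>_def)
          moreover have "0 \<le> K / real n powr \<beta>" "0 \<le> H" "0 \<le> H * \<eta>" using K H \<eta> by auto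
          ultimately show ?thesis by (metis ennreal_mult')
        qed
        finally show "ennreal_powr (ennreal (h powr - \<alpha>) * Lp_norm p (fdiff k \<delta> (fdiff r h f))) p1
          \<le> ennreal (K / real n powr \<beta>) * (E 0 + G) + ennreal e" .
      qed
      also have "\<dots> \<le> ennreal (K / real n powr \<beta>) * (S + ennreal (4 * 2 powr \<beta>) * S)"
      proof (intro mult_left_mono add_mono)
        show "E 0 \<le> S"
          unfolding S_def by (subst sum.atLeast_Suc_atMost) auto
        have "G \<le> ennreal (4 * 2 powr \<beta>) * (\<Sum>\<nu>=0..2 ^ m. ennreal (real (\<nu> + 1) powr (\<beta> - 1)) * E \<nu>)"
          unfolding G_def by (rule dyadic_sum_le[OF E \<beta>])
        also have "\<dots> \<le> ennreal (4 * 2 powr \<beta>) * S"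
          unfolding S_def using m by (intro mult_left_mono sum_mono2) auto
        finally show "G \<le> ennreal (4 * 2 powr \<beta>) * S" .
      qed auto
      also have "\<dots> = ennreal (K / real n powr \<beta>) * (ennreal (1 + 4 * 2 powr \<beta>) * S)"
        by (simp add: distrib_right)
      also have "\<dots> = ennreal (L / real n powr \<beta>) * S"
      proof -
        have "L / real n powr \<beta> = K / real n powr \<beta> * (1 + 4 * 2 powr \<beta>)" by (simp add: L_def)
        moreover have "0 \<le> K / real n powr \<beta>" using K by simp
        ultimately show ?thesis by (metis ennreal_mult' mult.assoc)
      qed
      also have "\<dots> = ennreal_powr (ennreal (C / real n ^ k) * ennreal_powr S (1 / p1)) p1"
      proof -
        have "(C / real n ^ k) powr p1 = L / real n powr \<beta>"
          using p1 L n by (simp add: C_def \<beta>_def powr_divide powr_powr powr_realpow[symmetric])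
        then show ?thesis
          using p1 C by (simp add: ennreal_powr_mult ennreal_powr_powr ennreal_powr_ennreal)
      qed
      finally show "ennreal_powr (ennreal (h powr - \<alpha>) * Lp_norm p (fdiff k \<delta> (fdiff r h f))) p1
          \<le> \<dots>" .
    qed
    then show "psi_modulus k r \<alpha> p f (1 / real n) \<le>
      ennreal (C / real n ^ k) *
      ennreal_powr
        (\<Sum>\<nu>=0..n. ennreal (real (\<nu> + 1) powr (real k * p1 - 1)) *
                   ennreal_powr (best_approx p r \<alpha> \<nu> f) p1)
        (1 / p1)"
      unfolding psi_modulus_def modulus_def SUP_mult_left_ennreal S_def E_def \<beta>_def
      by (intro SUP_least) auto
  qed
qed

end
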